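(* Let $f=f_1+\mathrm{i}f_2\in \mathrm{L}^2(-\pi,\pi)$ be $2\pi$-periodic with $f_1$ real-valued and even and $f_2$ real-valued and odd. Let $p=p_1+\mathrm{i}p_2$ be a trigonometric polynomial with $p_1$ real-valued and even and $p_2$ real-valued and odd, such that the Toeplitz matrices $T_n(p)$ are invertible, $\operatorname{Re}\left(\frac{f}{p}\right)>0$, and $$0<\alpha=\operatorname*{ess\,inf}_{-\pi\le x\le\pi}\left|\frac{f(x)}{p(x)}\right|\le \operatorname*{ess\,sup}_{-\pi\le x\le\pi}\left|\frac{f(x)}{p(x)}\right|=\beta<\infty .$$ Then the interval $[\alpha,\beta]$ is a general cluster for the singular values of the preconditioned matrices $T_n^{-1}(p)T_n(f)$.
   Context: For an integrable $2\pi$-periodic function $h$, $T_n(h)$ is the $n\times n$ Toeplitz matrix with $(j,k)$ entry $\frac{1}{2\pi}\int_{-\pi}^{\pi}h(x)\mathrm{e}^{-\mathrm{i}(j-k)x}\,\mathrm{d}x$, and $T_n^{-1}(h)=(T_n(h))^{-1}$. General cluster: for a sequence $\{A_n\}$, $A_n\in\mathbb{C}^{n\times n}$, and a set $\Phi$, let $\gamma_n(\varepsilon)$ be the number of singular values of $A_n$ (with multiplicity) lying outside the $\varepsilon$-extension $\Phi_\varepsilon$ (the union of $\Phi$ with all $\varepsilon$-balls centred at points of $\Phi$). $\Phi$ is a general cluster for the singular values of $\{A_n\}$ if $\lim_{n\to\infty}\gamma_n(\varepsilon)/n=0$ for every $\varepsilon>0$. *)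

theory Defs
  imports
    "HOL-Probability.Essential_Supremum"
    "Jordan_Normal_Form.Schur_Decomposition"
    "Jordan_Normal_Form.Gauss_Jordan_Elimination"
begin

definition square_integrable :: "(real \<Rightarrow> complex) \<Rightarrow> bool" where
  "square_integrable h \<longleftrightarrow>
     set_borel_measurable lebesgue {-pi..pi} h \<and>
     set_integrable lebesgue {-pi..pi} (\<lambda>x. (cmod (h x))\<^sup>2)"

definition trig_polynomial :: "(real \<Rightarrow> complex) \<Rightarrow> bool" where
  "trig_polynomial h \<longleftrightarrow>
     (\<exists>(N::nat) (c :: int \<Rightarrow> complex).
        \<forall>x. h x = (\<Sum>k\<in>{- int N..int N}. c k * exp (\<i> * of_int k * of_real x)))"

(* Rows and columns are indexed from 0; the entries depend only on j - k. *)
definition toeplitz :: "(real \<Rightarrow> complex) \<Rightarrow> nat \<Rightarrow> complex mat" where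
  "toeplitz h n = mat n n (\<lambda>(j, k).
     1 / (2 * of_real pi) *
     set_lebesgue_integral lebesgue {-pi..pi}
       (\<lambda>x. h x * exp (- \<i> * of_int (int j - int k) * of_real x)))"

(* The Gauss-Jordan inverse of the library; meaningful only for invertible matrices. *)
definition inverse_mat :: "complex mat \<Rightarrow> complex mat" where
  "inverse_mat A = the (mat_inverse A)"

(* Square roots of the eigenvalues of A^* A, with multiplicity. These eigenvalues
   are real and nonnegative, so Re discards nothing. *)
definition singular_values :: "complex mat \<Rightarrow> real multiset" where
  "singular_values A =
     image_mset (\<lambda>z. sqrt (Re z)) (proots (char_poly (mat_adjoint A * A)))"

definition eps_extension :: "real set \<Rightarrow> real \<Rightarrow> real set" where
  "eps_extension \<Phi> \<epsilon> = \<Phi> \<union> (\<Union>x\<in>\<Phi>. ball x \<epsilon>)"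

definition outlier_count :: "real set \<Rightarrow> real \<Rightarrow> complex mat \<Rightarrow> nat" where
  "outlier_count \<Phi> \<epsilon> A =
     size (filter_mset (\<lambda>s. s \<notin> eps_extension \<Phi> \<epsilon>) (singular_values A))"

definition general_cluster :: "real set \<Rightarrow> (nat \<Rightarrow> complex mat) \<Rightarrow> bool" where
  "general_cluster \<Phi> A \<longleftrightarrow>
     (\<forall>\<epsilon>>0. (\<lambda>n. real (outlier_count \<Phi> \<epsilon> (A n)) / real n) \<longlonglongrightarrow> 0)"

(* Dual of the library's esssup, with the dual convention for non-measurable functions. *)
definition essinf :: "'a measure \<Rightarrow> ('a \<Rightarrow> ereal) \<Rightarrow> ereal" where
  "essinf M f = (if f \<in> borel_measurable M then Liminf (ae_filter M) f else bot)"

end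

theory Submission
  imports Defs
begin

text \<open>
  Put \<open>g = f / p\<close>, so that \<open>\<alpha> \<le> |g| \<le> \<beta>\<close> almost everywhere and \<open>f = g p\<close>, and let \<open>N\<close> be the
  degree of \<open>p\<close>. Multiplication by \<open>p\<close> only mixes frequencies at distance at most \<open>N\<close>, so the rows
  of \<open>T\<^sub>n(f)\<close> and of \<open>T\<^sub>n(p) T\<^sub>n(g)\<close> coincide except for the first and the last \<open>N\<close> of them
  (\<open>toeplitz_product_interior_row\<close>). Hence \<open>T\<^sub>n(p)\<^sup>-\<^sup>1 T\<^sub>n(f)\<close> agrees with \<open>T\<^sub>n(g)\<close> on a subspace of
  codimension at most \<open>2 N\<close>, and the number of singular values on either side of a threshold
  differs for the two matrices by at most \<open>2 N\<close> (\<open>singular_value_count_perturbation\<close>). As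
  \<open>2 N / n\<close> tends to \<open>0\<close>, it suffices to count for \<open>T\<^sub>n(g)\<close>.

  The matrix \<open>T\<^sub>n(g)\<close> is the compression of multiplication by \<open>g\<close> to the span of the frequencies
  \<open>0, \<dots>, n - 1\<close>, so no singular value exceeds \<open>\<beta>\<close>. Multiplication by \<open>g\<close> itself stretches every
  vector by at least \<open>\<alpha>\<close>; a singular value of \<open>T\<^sub>n(g)\<close> below \<open>t < \<alpha>\<close> can only arise because the
  compression discards at least \<open>\<alpha>\<^sup>2 - t\<^sup>2\<close> of the squared length of the image of a unit vector. The
  total amount discarded, summed over an orthonormal basis of singular vectors, is a trace and can
  be computed in the basis of frequencies: it equals \<open>n \<parallel>g\<parallel>\<^sup>2\<close> minus the sum of \<open>|g\<^sub>j\<^sub>-\<^sub>k|\<^sup>2\<close> over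
  \<open>j, k < n\<close>, where \<open>g\<^sub>m\<close> are the Fourier coefficients (\<open>toeplitz_defect_trace\<close>). By Parseval's
  identity this is \<open>o(n)\<close> (\<open>toeplitz_defect_tendsto\<close>), because all columns except those near the
  edges capture almost the whole of \<open>\<parallel>g\<parallel>\<^sup>2\<close>. So only \<open>o(n)\<close> singular values lie below
  \<open>t\<close> (\<open>toeplitz_singular_values\<close>).
\<close>

section \<open>Orthonormal eigenbases and singular values\<close>

lemma mat_adjoint_dim [simp]:
  "dim_row (mat_adjoint A) = dim_col A" "dim_col (mat_adjoint A) = dim_row A"
  by (simp_all add: mat_adjoint_def)

lemma mat_adjoint_carrier [simp]: "A \<in> carrier_mat m n \<Longrightarrow> mat_adjoint A \<in> carrier_mat n m"
  by (intro carrier_matI) auto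

lemma mat_adjoint_index [simp]:
  "i < dim_col A \<Longrightarrow> j < dim_row A \<Longrightarrow> mat_adjoint A $$ (i, j) = conjugate (A $$ (j, i))"
  by (simp add: mat_adjoint_def mat_of_rows_index)

lemma mat_adjoint_adjoint [simp]: "mat_adjoint (mat_adjoint A) = A"
  by (rule eq_matI) auto

lemma mat_adjoint_mult:
  fixes A B :: "complex mat"
  assumes "A \<in> carrier_mat m n" "B \<in> carrier_mat n k"
  shows "mat_adjoint (A * B) = mat_adjoint B * mat_adjoint A"
proof (rule eq_matI)
  fix i j assume "i < dim_row (mat_adjoint B * mat_adjoint A)" "j < dim_col (mat_adjoint B * mat_adjoint A)"
  then show "mat_adjoint (A * B) $$ (i, j) = (mat_adjoint B * mat_adjoint A) $$ (i, j)"
    using assms by (auto simp: scalar_prod_def mult.commute intro!: sum.cong)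
qed (use assms in auto)

definition sqnorm :: "complex vec \<Rightarrow> real" where
  "sqnorm v = (\<Sum>k<dim_vec v. (cmod (v $ k))\<^sup>2)"

lemma sqnorm_nonneg [simp]: "sqnorm v \<ge> 0"
  by (simp add: sqnorm_def sum_nonneg)

lemma sqnorm_eq_0_iff: "v \<in> carrier_vec n \<Longrightarrow> sqnorm v = 0 \<longleftrightarrow> v = 0\<^sub>v n"
  by (auto simp: sqnorm_def sum_nonneg_eq_0_iff)

lemma sqnorm_conv_scalar_prod: "complex_of_real (sqnorm v) = v \<bullet>c v"
  by (simp add: sqnorm_def scalar_prod_def complex_norm_square atLeast0LessThan
     del: of_real_power)

lemma scalar_prod_adjoint:
  fixes A :: "complex mat"
  assumes "A \<in> carrier_mat m n" "v \<in> carrier_vec n" "w \<in> carrier_vec m"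
  shows "(A *\<^sub>v v) \<bullet>c w = v \<bullet>c (mat_adjoint A *\<^sub>v w)"
proof -
  have "(A *\<^sub>v v) \<bullet>c w = (\<Sum>i<m. (\<Sum>j<n. A $$ (i, j) * v $ j) * cnj (w $ i))"
    using assms by (simp add: scalar_prod_def atLeast0LessThan)
  also have "\<dots> = (\<Sum>j<n. \<Sum>i<m. v $ j * (A $$ (i, j) * cnj (w $ i)))"
    unfolding sum_distrib_right by (subst sum.swap) (simp add: ac_simps)
  also have "\<dots> = v \<bullet>c (mat_adjoint A *\<^sub>v w)"
    using assms by (simp add: scalar_prod_def atLeast0LessThan sum_distrib_left)
  finally show ?thesis .
qed

text \<open>The Gram-Schmidt process yields an orthogonal basis that keeps the given vector in front;
  dividing each vector by its length makes the basis unitary, which rescales the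
  first column by the factor \<open>c\<close>.\<close>
lemma unitary_completion:
  fixes v :: "complex vec"
  assumes v: "v \<in> carrier_vec n" "v \<noteq> 0\<^sub>v n"
  obtains W c where "W \<in> carrier_mat n n" "mat_adjoint W * W = 1\<^sub>m n" "c \<noteq> 0" "col W 0 = c \<cdot>\<^sub>v v"
proof -
  interpret cof_vec_space n "TYPE(complex)" .
  define ws where "ws = gram_schmidt n (basis_completion v)"
  note bc = basis_completion[OF v]
  from gram_schmidt_result[OF bc(2,4,5) refl, folded ws_def]
  have ws: "set ws \<subseteq> carrier_vec n" "corthogonal ws" "length ws = n"
    using bc by auto
  have n: "n \<noteq> 0" using v by (cases "n = 0") auto
  with bc(6,7) obtain vs where "basis_completion v = v # vs"
    by (cases "basis_completion v") auto
  with gram_schmidt_hd[OF v(1), of vs] have "hd ws = v" by (simp add: ws_def)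
  then have hd: "ws ! 0 = v" using n ws(3) by (cases ws) auto
  have wsc: "ws ! i \<in> carrier_vec n" if "i < n" for i using that ws by auto
  define r where "r i = 1 / sqrt (sqnorm (ws ! i))" for i
  have nz: "sqnorm (ws ! i) \<noteq> 0" if "i < n" for i
    using corthogonalD[OF ws(2), of i i] that ws(3) sqnorm_conv_scalar_prod[of "ws ! i"] by auto
  define W where "W = mat n n (\<lambda>(k, i). complex_of_real (r i) * (ws ! i) $ k)"
  have WW: "mat_adjoint W * W = 1\<^sub>m n"
  proof (rule eq_matI)
    fix i j assume ij': "i < dim_row (1\<^sub>m n :: complex mat)" "j < dim_col (1\<^sub>m n :: complex mat)"
    then have ij: "i < n" "j < n" by auto
    have "(mat_adjoint W * W) $$ (i, j)
        = (\<Sum>k<n. complex_of_real (r i) * complex_of_real (r j) * ((ws ! j) $ k * cnj ((ws ! i) $ k)))"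
      using ij by (simp add: W_def scalar_prod_def atLeast0LessThan ac_simps)
    also have "\<dots> = complex_of_real (r i * r j) * (ws ! j \<bullet>c ws ! i)"
      using ij wsc[OF ij(1)] wsc[OF ij(2)]
      by (simp add: scalar_prod_def atLeast0LessThan sum_distrib_left)
    also have "\<dots> = (if i = j then 1 else 0)"
    proof (cases "i = j")
      case True
      have "r i * r i * sqnorm (ws ! i) = 1"
        using nz[OF ij(1)] sqnorm_nonneg[of "ws ! i"] unfolding r_def by simp
      then show ?thesis using True
        by (simp flip: sqnorm_conv_scalar_prod of_real_mult)
    next
      case False
      then show ?thesis using corthogonalD[OF ws(2), of j i] ij ws(3) by auto
    qed
    finally show "(mat_adjoint W * W) $$ (i, j) = 1\<^sub>m n $$ (i, j)" using ij by simp
  qed (auto simp: W_def)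
  show thesis
  proof (rule that[of W "complex_of_real (r 0)"])
    show "complex_of_real (r 0) \<noteq> 0" using nz[of 0] n by (simp add: r_def)
    show "col W 0 = complex_of_real (r 0) \<cdot>\<^sub>v v"
      using n hd v by (intro eq_vecI) (auto simp: W_def)
  qed (use WW in \<open>auto simp: W_def\<close>)
qed

lemma unitary_right_inverse:
  assumes "(W :: complex mat) \<in> carrier_mat n n" "mat_adjoint W * W = 1\<^sub>m n"
  shows "W * mat_adjoint W = 1\<^sub>m n"
  using mat_mult_left_right_inverse[OF mat_adjoint_carrier[OF assms(1)] assms(1) assms(2)] .

text \<open>Triangularisation only provides a similarity, whereas counting singular values needs an
  orthonormal eigenbasis. Induction on the size: conjugating by a unitary matrix whose first column
  is an eigenvector clears the rest of the first column, hence, the matrix being Hermitian, also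
  the rest of the first row.\<close>
lemma hermitian_spectral:
  fixes A :: "complex mat"
  assumes "A \<in> carrier_mat n n" "mat_adjoint A = A"
  obtains U D where "U \<in> carrier_mat n n" "D \<in> carrier_mat n n" "mat_adjoint U * U = 1\<^sub>m n"
    "diagonal_mat D" "A = U * D * mat_adjoint U"
proof -
  have "\<exists>U D. U \<in> carrier_mat n n \<and> D \<in> carrier_mat n n \<and> mat_adjoint U * U = 1\<^sub>m n \<and>
     diagonal_mat D \<and> A = U * D * mat_adjoint U"
    using assms
  proof (induction n arbitrary: A)
    case 0
    then show ?case
      by (intro exI[of _ "1\<^sub>m 0"] exI[of _ A]) (auto simp: diagonal_mat_def)
  next
    case (Suc n A)
    note A = Suc.prems(1)
    have "degree (char_poly A) = Suc n" using degree_monic_char_poly[OF A] by simp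
    then have "\<not> constant (poly (char_poly A))"
      by (simp add: constant_degree)
    then obtain e where "poly (char_poly A) e = 0"
      using fundamental_theorem_of_algebra by blast
    then have "eigenvalue A e" using eigenvalue_root_char_poly[OF A] by simp
    then obtain v where v: "v \<in> carrier_vec (Suc n)" "v \<noteq> 0\<^sub>v (Suc n)" "A *\<^sub>v v = e \<cdot>\<^sub>v v"
      using A unfolding eigenvalue_def eigenvector_def by auto
    obtain W c where W: "W \<in> carrier_mat (Suc n) (Suc n)" "mat_adjoint W * W = 1\<^sub>m (Suc n)"
      and c: "c \<noteq> 0" "col W 0 = c \<cdot>\<^sub>v v"
      using unitary_completion[OF v(1,2)] by blast
    note W' = unitary_right_inverse[OF W] mat_adjoint_carrier[OF W(1)]
    define H where "H = mat_adjoint W * (A * W)"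
    have AW: "A * W \<in> carrier_mat (Suc n) (Suc n)" using W A by simp
    have H: "H \<in> carrier_mat (Suc n) (Suc n)" by (simp add: H_def AW mult_carrier_mat[OF W'(2) AW])
    have H_herm: "mat_adjoint H = H"
      unfolding H_def using W W' A Suc.prems(2)
      by (simp add: mat_adjoint_mult[OF W'(2) AW] mat_adjoint_mult[OF A W(1)]
          assoc_mult_mat[OF W'(2) A W(1)])
    have col0W: "col W 0 \<in> carrier_vec (Suc n)" using W(1) by (auto simp: col_def)
    have "col H 0 = mat_adjoint W *\<^sub>v (A *\<^sub>v col W 0)"
      unfolding H_def by (simp add: col_mult2[OF W'(2) AW] col_mult2[OF A W(1)])
    also have "A *\<^sub>v col W 0 = e \<cdot>\<^sub>v col W 0"
      using A v c by (simp add: mult_mat_vec[OF A] smult_smult_assoc mult.commute)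
    also have "mat_adjoint W *\<^sub>v (e \<cdot>\<^sub>v col W 0) = e \<cdot>\<^sub>v col (mat_adjoint W * W) 0"
      using mult_mat_vec[OF W'(2) col0W, of e] by (simp add: col_mult2[OF W'(2) W(1)])
    finally have col0: "col H 0 = e \<cdot>\<^sub>v unit_vec (Suc n) 0" using W(2) by simp
    have H_i0: "H $$ (i, 0) = (if i = 0 then e else 0)" if "i < Suc n" for i
      using arg_cong[OF col0, of "\<lambda>x. x $ i"] H that by (simp add: unit_vec_def)
    have H_0i: "H $$ (0, i) = 0" if "i < Suc n" "i \<noteq> 0" for i
      using arg_cong[OF H_herm, of "\<lambda>M. M $$ (0, i)"] H_i0[of i] that H by auto
    \<comment> \<open>the block that remains after splitting off the eigenvalue\<close>
    define H' where "H' = mat n n (\<lambda>(i, j). H $$ (Suc i, Suc j))"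
    define E where "E = mat 1 1 (\<lambda>_. e)"
    have H'_herm: "mat_adjoint H' = H'"
    proof (rule eq_matI)
      fix i j assume ij: "i < dim_row H'" "j < dim_col H'"
      then show "mat_adjoint H' $$ (i, j) = H' $$ (i, j)"
        using arg_cong[OF H_herm, of "\<lambda>M. M $$ (Suc i, Suc j)"] H by (simp add: H'_def)
    qed (simp_all add: H'_def)
    obtain V D where V: "V \<in> carrier_mat n n" "mat_adjoint V * V = 1\<^sub>m n"
      and D: "D \<in> carrier_mat n n" "diagonal_mat D" and H'_eq: "H' = V * D * mat_adjoint V"
      using Suc.IH[OF _ H'_herm] by (auto simp: H'_def)
    note V' = mat_adjoint_carrier[OF V(1)]
    have H_block: "H = four_block_mat E (0\<^sub>m 1 n) (0\<^sub>m n 1) H'"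
      by (rule eq_matI) (use H in \<open>auto simp: E_def H'_def H_i0 H_0i\<close>)
    define V1 where "V1 = four_block_mat (1\<^sub>m 1) (0\<^sub>m 1 n) (0\<^sub>m n 1) V"
    define D1 where "D1 = four_block_mat E (0\<^sub>m 1 n) (0\<^sub>m n 1) D"
    have V1: "V1 \<in> carrier_mat (Suc n) (Suc n)"
      unfolding V1_def using four_block_carrier_mat[OF one_carrier_mat V(1)] by fastforce
    have D1: "D1 \<in> carrier_mat (Suc n) (Suc n)"
      unfolding D1_def E_def using four_block_carrier_mat[of "mat 1 1 (\<lambda>_. e)" 1 1, OF _ D(1)] by fastforce
    have V1_adj: "mat_adjoint V1 = four_block_mat (1\<^sub>m 1) (0\<^sub>m 1 n) (0\<^sub>m n 1) (mat_adjoint V)"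
      by (rule eq_matI) (use V in \<open>auto simp: V1_def\<close>)
    have unit: "mat_adjoint V1 * V1 = 1\<^sub>m (Suc n)"
      unfolding V1_adj unfolding V1_def
      using V V' by (subst mult_four_block_mat[of _ 1 1 _ n _ n _ _ 1 _ n]) auto
    have E: "E \<in> carrier_mat 1 1" by (simp add: E_def)
    have "V1 * D1 = four_block_mat E (0\<^sub>m 1 n) (0\<^sub>m n 1) (V * D)"
      unfolding V1_def D1_def
      using V V' D E by (subst mult_four_block_mat[of _ 1 1 _ n _ n _ _ 1 _ n]) auto
    then have H_eq: "H = V1 * D1 * mat_adjoint V1"
      unfolding V1_adj H_block H'_eq
      using V V' D E by (simp, subst mult_four_block_mat[of _ 1 1 _ n _ n _ _ 1 _ n]) auto
    have VA: "mat_adjoint V1 \<in> carrier_mat (Suc n) (Suc n)" using V1 by simp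
    have VD: "V1 * D1 \<in> carrier_mat (Suc n) (Suc n)" using V1 D1 by simp
    have diag: "diagonal_mat D1"
      using D unfolding diagonal_mat_def D1_def E_def by (auto split: if_splits)
    have "A = (A * W) * mat_adjoint W"
      using W' A by (simp add: assoc_mult_mat[OF A W(1) W'(2)])
    also have "A * W = (W * mat_adjoint W) * (A * W)" unfolding W'(1) by (rule left_mult_one_mat[OF AW, symmetric])
    also have "\<dots> = W * H" unfolding H_def by (rule assoc_mult_mat[OF W(1) W'(2) AW])
    also have "W * H = W * (V1 * D1) * mat_adjoint V1"
      unfolding H_eq by (rule assoc_mult_mat[OF W(1) VD VA, symmetric])
    also have "W * (V1 * D1) = (W * V1) * D1" by (rule assoc_mult_mat[OF W(1) V1 D1, symmetric])
    also have "\<dots> * mat_adjoint V1 * mat_adjoint W = \<dots> * mat_adjoint (W * V1)"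
      unfolding mat_adjoint_mult[OF W(1) V1]
      by (rule assoc_mult_mat[OF _ VA W'(2)]) (use W(1) V1 D1 in auto)
    finally have A_eq: "A = (W * V1) * D1 * mat_adjoint (W * V1)" .
    have "mat_adjoint (W * V1) * (W * V1) = mat_adjoint V1 * ((mat_adjoint W * W) * V1)"
      unfolding mat_adjoint_mult[OF W(1) V1]
      using W(1) W' V1 mat_adjoint_carrier[OF V1]
      by (simp add: assoc_mult_mat[of _ "Suc n" "Suc n" _ "Suc n" _ "Suc n"])
    also have "\<dots> = 1\<^sub>m (Suc n)" using W(2) V1 unit by simp
    finally show ?case
      using A_eq W(1) V1 D1 diag by (intro exI[of _ "W * V1"] exI[of _ D1]) auto
  qed
  then show thesis using that by blast
qed

text \<open>The form in which singular values are used below: the vectors \<open>b i\<close> are right singular vectors,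
  so in the coordinates \<open>v \<bullet>c (b i)\<close> both the length of \<open>v\<close> and the length of its image are
  weighted sums of squares.\<close>
lemma singular_value_decomposition:
  fixes A :: "complex mat"
  assumes A: "A \<in> carrier_mat n n"
  obtains b s where
    "\<And>i. i < n \<Longrightarrow> b i \<in> carrier_vec n"
    "\<And>i j. i < n \<Longrightarrow> j < n \<Longrightarrow> b i \<bullet>c (b j) = (if i = j then 1 else 0)"
    "\<And>i. i < n \<Longrightarrow> s i \<ge> 0"
    "\<And>v. v \<in> carrier_vec n \<Longrightarrow> sqnorm v = (\<Sum>i<n. (cmod (v \<bullet>c (b i)))\<^sup>2)"
    "\<And>v. v \<in> carrier_vec n \<Longrightarrow> sqnorm (A *\<^sub>v v) = (\<Sum>i<n. (s i)\<^sup>2 * (cmod (v \<bullet>c (b i)))\<^sup>2)"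
    "singular_values A = image_mset s (mset_set {..<n})"
proof -
  define M where "M = mat_adjoint A * A"
  have A': "mat_adjoint A \<in> carrier_mat n n" using A by simp
  have M: "M \<in> carrier_mat n n" "mat_adjoint M = M"
    using A A' by (auto simp: M_def mat_adjoint_mult[OF A' A])
  obtain U D where U: "U \<in> carrier_mat n n" "mat_adjoint U * U = 1\<^sub>m n"
    and D: "D \<in> carrier_mat n n" "diagonal_mat D" and M_eq: "M = U * D * mat_adjoint U"
    using hermitian_spectral[OF M] by blast
  note U' = mat_adjoint_carrier[OF U(1)] unitary_right_inverse[OF U]
  define b where "b i = col U i" for i
  define s where "s i = sqrt (Re (D $$ (i, i)))" for i
  have b: "b i \<in> carrier_vec n" if "i < n" for i using U that by (auto simp: b_def)
  have coord: "(mat_adjoint U *\<^sub>v v) $ i = v \<bullet>c (b i)" if "v \<in> carrier_vec n" "i < n" for v i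
    using that U by (simp add: b_def scalar_prod_def atLeast0LessThan mult.commute)
  have ortho: "b i \<bullet>c (b j) = (if i = j then 1 else 0)" if "i < n" "j < n" for i j
  proof -
    have "b i \<bullet>c (b j) = (mat_adjoint U * U) $$ (j, i)"
      using that U(1) by (simp add: b_def scalar_prod_def atLeast0LessThan mult.commute)
    then show ?thesis using that U(2) by auto
  qed
  have pars: "sqnorm v = (\<Sum>i<n. (cmod (v \<bullet>c (b i)))\<^sup>2)" if v: "v \<in> carrier_vec n" for v
  proof -
    have "complex_of_real (sqnorm v) = (U *\<^sub>v (mat_adjoint U *\<^sub>v v)) \<bullet>c v"
      using v U U' by (simp add: sqnorm_conv_scalar_prod flip: assoc_mult_mat_vec[OF U(1) U'(1)])
    also have "\<dots> = (mat_adjoint U *\<^sub>v v) \<bullet>c (mat_adjoint U *\<^sub>v v)"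
      using v U' by (intro scalar_prod_adjoint[OF U(1)]) auto
    finally have "sqnorm v = sqnorm (mat_adjoint U *\<^sub>v v)"
      by (simp flip: sqnorm_conv_scalar_prod)
    then show ?thesis using v U coord by (simp add: sqnorm_def)
  qed
  have sq: "complex_of_real (sqnorm (A *\<^sub>v v)) = (\<Sum>i<n. D $$ (i, i) * (cmod (v \<bullet>c (b i)))\<^sup>2)"
    if v: "v \<in> carrier_vec n" for v
  proof -
    let ?w = "mat_adjoint U *\<^sub>v v"
    have w: "?w \<in> carrier_vec n" using v U' by simp
    have "complex_of_real (sqnorm (A *\<^sub>v v)) = (mat_adjoint A *\<^sub>v (A *\<^sub>v v)) \<bullet>c v"
      using v A A' by (subst scalar_prod_adjoint[OF A']) (auto simp: sqnorm_conv_scalar_prod)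
    also have "mat_adjoint A *\<^sub>v (A *\<^sub>v v) = M *\<^sub>v v"
      unfolding M_def by (rule assoc_mult_mat_vec[OF A' A v, symmetric])
    also have "\<dots> = U *\<^sub>v (D *\<^sub>v ?w)"
      using v U U' D w unfolding M_eq by (simp add: assoc_mult_mat_vec[of _ n n _ n])
    also have "\<dots> \<bullet>c v = (D *\<^sub>v ?w) \<bullet>c ?w"
      using v U' D w by (intro scalar_prod_adjoint[OF U(1)]) auto
    also have "\<dots> = (\<Sum>i<n. (D *\<^sub>v ?w) $ i * cnj (?w $ i))"
      using U D by (simp add: scalar_prod_def atLeast0LessThan)
    also have "\<dots> = (\<Sum>i<n. D $$ (i, i) * (cmod (v \<bullet>c (b i)))\<^sup>2)"
    proof (intro sum.cong refl)
      fix i assume "i \<in> {..<n}"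
      then have i: "i < n" by simp
      have "(D *\<^sub>v ?w) $ i = (\<Sum>k<n. D $$ (i, k) * ?w $ k)"
        using D U w i by (simp add: scalar_prod_def atLeast0LessThan)
      also have "\<dots> = (\<Sum>k<n. if k = i then D $$ (i, i) * ?w $ i else 0)"
        using D i by (intro sum.cong) (auto simp: diagonal_mat_def)
      also have "\<dots> = D $$ (i, i) * ?w $ i" using i by simp
      finally show "(D *\<^sub>v ?w) $ i * cnj (?w $ i) = D $$ (i, i) * (cmod (v \<bullet>c (b i)))\<^sup>2"
        using coord[OF v i] by (simp add: mult.assoc complex_norm_square del: of_real_power)
    qed
    finally show ?thesis .
  qed
  \<comment> \<open>evaluating at the eigenvectors shows that the eigenvalues are real and nonnegative\<close>
  have dia: "D $$ (i, i) = complex_of_real (sqnorm (A *\<^sub>v b i))" if i: "i < n" for i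
  proof -
    have "(\<Sum>k<n. D $$ (k, k) * (cmod (b i \<bullet>c (b k)))\<^sup>2) = (\<Sum>k<n. if k = i then D $$ (i, i) else 0)"
      using i by (intro sum.cong) (auto simp: ortho)
    then show ?thesis using sq[OF b[OF i]] i by simp
  qed
  have s: "s i \<ge> 0" "(s i)\<^sup>2 = Re (D $$ (i, i))" if "i < n" for i
    using dia[OF that] by (auto simp: s_def)
  have "similar_mat M D"
    using U U' D M(1) M_eq by (intro similar_matI[of _ _ U "mat_adjoint U" n]) auto
  then have "char_poly M = char_poly D" by (rule char_poly_similar)
  also have "upper_triangular D" using D by (auto simp: diagonal_mat_def upper_triangular_def)
  then have "char_poly D = (\<Prod>a\<leftarrow>diag_mat D. [:- a, 1:])"
    by (rule char_poly_upper_triangular[OF D(1)])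
  finally have "proots (char_poly M) = mset (diag_mat D)"
  proof -
    assume *: "char_poly M = (\<Prod>a\<leftarrow>diag_mat D. [:- a, 1:])"
    have "proots (\<Prod>a\<leftarrow>xs. [:- a, 1:]) = mset xs" for xs :: "complex list"
    proof (induction xs)
      case (Cons x xs)
      have "(\<Prod>a\<leftarrow>xs. [:- a, 1:]) \<noteq> 0"
        by (auto simp: prod_list_zero_iff)
      then show ?case using Cons by (simp add: proots_mult del: mult_pCons_left)
    qed simp
    then show ?thesis using * by simp
  qed
  also have "mset (diag_mat D) = image_mset (\<lambda>i. D $$ (i, i)) (mset_set {..<n})"
    using D by (simp add: diag_mat_def atLeast0LessThan)
  finally have "proots (char_poly M) = image_mset (\<lambda>i. D $$ (i, i)) (mset_set {..<n})" .
  moreover have "s = (\<lambda>i. sqrt (Re (D $$ (i, i))))" by (simp add: s_def fun_eq_iff)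
  ultimately have sv: "singular_values A = image_mset s (mset_set {..<n})"
    by (simp add: singular_values_def M_def image_mset.compositionality comp_def)
  show thesis
  proof (rule that[of b s])
    fix v :: "complex vec" assume v: "v \<in> carrier_vec n"
    show "sqnorm (A *\<^sub>v v) = (\<Sum>i<n. (s i)\<^sup>2 * (cmod (v \<bullet>c (b i)))\<^sup>2)"
      using arg_cong[OF sq[OF v], of Re] s by simp
  qed (use b ortho s pars sv in auto)
qed

section \<open>Singular values under perturbations of small rank\<close>

text \<open>The functionals, padded with zero rows, form a singular square matrix.\<close>
lemma common_zero_of_functionals:
  fixes R :: "complex vec list"
  assumes "length R < n"
  obtains v where "v \<in> carrier_vec n" "v \<noteq> 0\<^sub>v n" "\<And>r. r \<in> set R \<Longrightarrow> r \<in> carrier_vec n \<Longrightarrow> r \<bullet> v = 0"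
proof -
  define M where "M = mat\<^sub>r n n (\<lambda>i. if i = length R then 0\<^sub>v n else
     if i < length R \<and> R ! i \<in> carrier_vec n then R ! i else 0\<^sub>v n)"
  have M: "M \<in> carrier_mat n n" by (simp add: M_def)
  have "det M = 0" unfolding M_def using assms by (intro det_row_0) auto
  then obtain v where v: "v \<in> carrier_vec n" "v \<noteq> 0\<^sub>v n" "M *\<^sub>v v = 0\<^sub>v n"
    using det_0_iff_vec_prod_zero[OF M] by blast
  show thesis
  proof (rule that[OF v(1,2)])
    fix r assume r: "r \<in> set R" "r \<in> carrier_vec n"
    then obtain i where i: "i < length R" "r = R ! i" by (auto simp: in_set_conv_nth)
    have "row M i = r" unfolding M_def using i r assms by auto
    then show "r \<bullet> v = 0"
      using arg_cong[OF v(3), of "\<lambda>w. w $ i"] i assms M by auto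
  qed
qed

text \<open>A dimension count in place of the min-max principle. If the inequality failed, then the right
  singular vectors of \<open>A\<close> above \<open>t\<close>, those of \<open>B\<close> up to \<open>t\<close> and the functionals in \<open>R\<close> would
  together impose fewer than \<open>n\<close> linear conditions. A nonzero common solution \<open>v\<close> is shrunk
  by \<open>A\<close> to at most \<open>t\<close> times its length and stretched by \<open>B\<close> to more than that, although
  \<open>A\<close> and \<open>B\<close> agree on it.\<close>
lemma singular_value_count_perturbation:
  fixes A B :: "complex mat" and R :: "complex vec list"
  assumes A: "A \<in> carrier_mat n n" and B: "B \<in> carrier_mat n n" and R: "set R \<subseteq> carrier_vec n"
    and agree: "\<And>v. v \<in> carrier_vec n \<Longrightarrow> (\<And>r. r \<in> set R \<Longrightarrow> r \<bullet> v = 0) \<Longrightarrow> A *\<^sub>v v = B *\<^sub>v v"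
    and t: "t \<ge> 0"
  shows "size {#s \<in># singular_values A. s \<le> t#} \<le> size {#s \<in># singular_values B. s \<le> t#} + length R"
proof -
  obtain a s where a: "\<And>i. i < n \<Longrightarrow> a i \<in> carrier_vec n"
    and A1: "\<And>v. v \<in> carrier_vec n \<Longrightarrow> sqnorm v = (\<Sum>i<n. (cmod (v \<bullet>c (a i)))\<^sup>2)"
    and A2: "\<And>v. v \<in> carrier_vec n \<Longrightarrow> sqnorm (A *\<^sub>v v) = (\<Sum>i<n. (s i)\<^sup>2 * (cmod (v \<bullet>c (a i)))\<^sup>2)"
    and s: "\<And>i. i < n \<Longrightarrow> s i \<ge> 0"
    and A3: "singular_values A = image_mset s (mset_set {..<n})"
    by (rule singular_value_decomposition[OF A]) blast
  obtain b r where b: "\<And>i. i < n \<Longrightarrow> b i \<in> carrier_vec n"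
    and B1: "\<And>v. v \<in> carrier_vec n \<Longrightarrow> sqnorm v = (\<Sum>i<n. (cmod (v \<bullet>c (b i)))\<^sup>2)"
    and B2: "\<And>v. v \<in> carrier_vec n \<Longrightarrow> sqnorm (B *\<^sub>v v) = (\<Sum>i<n. (r i)\<^sup>2 * (cmod (v \<bullet>c (b i)))\<^sup>2)"
    and B3: "singular_values B = image_mset r (mset_set {..<n})"
    by (rule singular_value_decomposition[OF B]) blast
  have cA: "size {#x \<in># singular_values A. x \<le> t#} = card {i. i < n \<and> s i \<le> t}"
    unfolding A3 by (simp add: filter_mset_image_mset Int_def lessThan_def conj_commute)
  have cB: "size {#x \<in># singular_values B. x \<le> t#} = card {i. i < n \<and> r i \<le> t}"
    unfolding B3 by (simp add: filter_mset_image_mset Int_def lessThan_def conj_commute)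
  have compl: "card {i. i < n \<and> s i \<le> t} + card {i. i < n \<and> t < s i} = n"
  proof -
    have "card ({i. i < n \<and> s i \<le> t} \<union> {i. i < n \<and> t < s i}) =
      card {i. i < n \<and> s i \<le> t} + card {i. i < n \<and> t < s i}"
      by (rule card_Un_disjoint) auto
    also have "{i. i < n \<and> s i \<le> t} \<union> {i. i < n \<and> t < s i} = {..<n}" by auto
    finally show ?thesis by simp
  qed
  define F where "F = map (\<lambda>i. conjugate (a i)) (filter (\<lambda>i. t < s i) [0..<n])
     @ map (\<lambda>i. conjugate (b i)) (filter (\<lambda>i. r i \<le> t) [0..<n]) @ R"
  have len_filter: "length (filter P [0..<n]) = card {i. i < n \<and> P i}" for P
    using distinct_card[of "filter P [0..<n]"] by (simp add: conj_commute)
  have "n \<le> length F"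
  proof (rule ccontr)
    assume "\<not> n \<le> length F"
    then obtain v where v: "v \<in> carrier_vec n" "v \<noteq> 0\<^sub>v n"
      and F: "\<And>x. x \<in> set F \<Longrightarrow> x \<in> carrier_vec n \<Longrightarrow> x \<bullet> v = 0"
      using common_zero_of_functionals[of F n] by (metis not_le)
    have perp_a: "v \<bullet>c (a i) = 0" if "i < n" "t < s i" for i
      using F[of "conjugate (a i)"] a[OF that(1)] that v by (auto simp: F_def comm_scalar_prod[of v n])
    have perp_b: "v \<bullet>c (b i) = 0" if "i < n" "r i \<le> t" for i
      using F[of "conjugate (b i)"] b[OF that(1)] that v by (auto simp: F_def comm_scalar_prod[of v n])
    have "sqnorm (A *\<^sub>v v) \<le> (\<Sum>i<n. t\<^sup>2 * (cmod (v \<bullet>c (a i)))\<^sup>2)"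
      unfolding A2[OF v(1)]
    proof (rule sum_mono)
      fix i assume "i \<in> {..<n}"
      then show "(s i)\<^sup>2 * (cmod (v \<bullet>c (a i)))\<^sup>2 \<le> t\<^sup>2 * (cmod (v \<bullet>c (a i)))\<^sup>2"
        using perp_a[of i] s[of i] by (cases "t < s i") (auto intro!: mult_right_mono power_mono)
    qed
    also have "\<dots> = (\<Sum>i<n. t\<^sup>2 * (cmod (v \<bullet>c (b i)))\<^sup>2)"
      using A1[OF v(1)] B1[OF v(1)] by (simp flip: sum_distrib_left)
    also have "\<dots> < (\<Sum>i<n. (r i)\<^sup>2 * (cmod (v \<bullet>c (b i)))\<^sup>2)"
    proof (rule sum_strict_mono_ex1)
      show "\<forall>i\<in>{..<n}. t\<^sup>2 * (cmod (v \<bullet>c (b i)))\<^sup>2 \<le> (r i)\<^sup>2 * (cmod (v \<bullet>c (b i)))\<^sup>2"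
      proof
        fix i assume "i \<in> {..<n}"
        then show "t\<^sup>2 * (cmod (v \<bullet>c (b i)))\<^sup>2 \<le> (r i)\<^sup>2 * (cmod (v \<bullet>c (b i)))\<^sup>2"
          using perp_b[of i] t by (cases "r i \<le> t") (auto intro!: mult_right_mono power_mono)
      qed
      have "sqnorm v \<noteq> 0" using v sqnorm_eq_0_iff by auto
      then obtain i where i: "i < n" "v \<bullet>c (b i) \<noteq> 0"
        unfolding B1[OF v(1)] by (auto elim!: sum.not_neutral_contains_not_neutral)
      then have "t < r i" using perp_b by force
      then have "t\<^sup>2 < (r i)\<^sup>2" using t by (intro power_strict_mono) auto
      then show "\<exists>i\<in>{..<n}. t\<^sup>2 * (cmod (v \<bullet>c (b i)))\<^sup>2 < (r i)\<^sup>2 * (cmod (v \<bullet>c (b i)))\<^sup>2"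
        using i by (intro bexI[of _ i] mult_strict_right_mono) auto
    qed simp
    also have "\<dots> = sqnorm (B *\<^sub>v v)" using B2[OF v(1)] by simp
    also have "B *\<^sub>v v = A *\<^sub>v v"
      by (rule agree[OF v(1), symmetric], rule F) (use R in \<open>auto simp: F_def\<close>)
    finally show False by simp
  qed
  then show ?thesis
    unfolding cA cB using compl by (simp add: F_def len_filter)
qed

section \<open>Fourier coefficients of bounded functions\<close>

text \<open>Only the values on \<open>[-\<pi>, \<pi>]\<close> enter the integrals below. Boundedness is asked for everywhere
  rather than almost everywhere: the quotient \<open>f / p\<close> can be modified on a null set, and then
  no exceptional sets have to be carried along.\<close>
definition bounded_measurable :: "(real \<Rightarrow> complex) \<Rightarrow> bool" where
  "bounded_measurable h \<longleftrightarrow> h \<in> borel_measurable (lebesgue_on {-pi..pi}) \<and> bounded (range h)"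

definition fourier_coeff :: "(real \<Rightarrow> complex) \<Rightarrow> int \<Rightarrow> complex" where
  "fourier_coeff h m = (\<integral>x. h x * cis (- of_int m * x) \<partial>lebesgue_on {-pi..pi}) / (2 * pi)"

definition mean_square :: "(real \<Rightarrow> complex) \<Rightarrow> real" where
  "mean_square h = (\<integral>x. (cmod (h x))\<^sup>2 \<partial>lebesgue_on {-pi..pi}) / (2 * pi)"

lemma finite_measure_circle: "finite_measure (lebesgue_on {-pi..pi})"
  by (rule finite_measureI) (simp add: emeasure_restrict_space space_restrict_space)

lemma bounded_measurable_const: "bounded_measurable (\<lambda>_. c)"
  by (simp add: bounded_measurable_def)

lemma bounded_measurable_cis: "bounded_measurable (\<lambda>x. cis (r * x))"
proof -
  have "continuous_on {-pi..pi} (\<lambda>x. cis (r * x))" by (intro continuous_intros)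
  then show ?thesis unfolding bounded_measurable_def
    by (auto intro!: continuous_imp_measurable_on_sets_lebesgue boundedI[of _ 1])
qed

lemma bounded_measurable_add:
  "bounded_measurable u \<Longrightarrow> bounded_measurable v \<Longrightarrow> bounded_measurable (\<lambda>x. u x + v x)"
  unfolding bounded_measurable_def using bounded_plus_comp[of u UNIV v] by (intro conjI borel_measurable_add) simp_all

lemma bounded_measurable_mult:
  assumes "bounded_measurable u" "bounded_measurable v"
  shows "bounded_measurable (\<lambda>x. u x * v x)"
proof -
  obtain a b where "\<And>x. cmod (u x) \<le> a" "\<And>x. cmod (v x) \<le> b"
    using assms unfolding bounded_measurable_def bounded_iff by auto
  then have "cmod (u x * v x) \<le> a * b" for x
    by (auto simp: norm_mult intro!: mult_mono order_trans[OF norm_ge_zero])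
  then show ?thesis using assms unfolding bounded_measurable_def by (auto intro!: boundedI)
qed

lemma bounded_measurable_cnj:
  assumes "bounded_measurable u"
  shows "bounded_measurable (\<lambda>x. cnj (u x))"
proof -
  have cnj: "cnj \<in> borel_measurable borel"
    by (intro borel_measurable_continuous_onI continuous_intros)
  have "(\<lambda>x. cnj (u x)) \<in> borel_measurable (lebesgue_on {-pi..pi})"
    by (rule measurable_compose[OF _ cnj]) (use assms in \<open>simp add: bounded_measurable_def\<close>)
  then show ?thesis using assms unfolding bounded_measurable_def bounded_iff by simp
qed

lemma bounded_measurable_uminus: "bounded_measurable u \<Longrightarrow> bounded_measurable (\<lambda>x. - u x)"
  using bounded_measurable_mult[OF bounded_measurable_const[of "-1"]] by simp

lemma bounded_measurable_diff:
  "bounded_measurable u \<Longrightarrow> bounded_measurable v \<Longrightarrow> bounded_measurable (\<lambda>x. u x - v x)"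
  using bounded_measurable_add[OF _ bounded_measurable_uminus] by fastforce

lemma bounded_measurable_sum:
  "(\<And>i. i \<in> I \<Longrightarrow> bounded_measurable (u i)) \<Longrightarrow> bounded_measurable (\<lambda>x. \<Sum>i\<in>I. u i x)"
  by (induction I rule: infinite_finite_induct)
     (auto intro: bounded_measurable_add bounded_measurable_const)

lemmas bounded_measurable_intros = bounded_measurable_const bounded_measurable_cis
  bounded_measurable_add bounded_measurable_mult bounded_measurable_cnj
  bounded_measurable_diff bounded_measurable_sum

lemma bounded_measurable_integrable:
  assumes "bounded_measurable h"
  shows "integrable (lebesgue_on {-pi..pi}) h"
proof -
  obtain C where "\<And>x. cmod (h x) \<le> C"
    using assms unfolding bounded_measurable_def bounded_iff by auto
  then show ?thesis
    using assms finite_measure.integrable_const_bound[OF finite_measure_circle]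
    unfolding bounded_measurable_def by blast
qed

lemma integral_cis:
  "(\<integral>x. cis (of_int m * x) \<partial>lebesgue_on {-pi..pi}) = (if m = 0 then 2 * pi else 0)"
proof (cases "m = 0")
  case True
  then show ?thesis
    by (simp add: measure_restrict_space scaleR_conv_of_real)
next
  case False
  define F where "F x = cis (of_int m * x) / (\<i> * of_int m)" for x :: real
  have "((\<lambda>x. cis (of_int m * x)) has_integral (F pi - F (-pi))) {-pi..pi}"
  proof (rule fundamental_theorem_of_calculus)
    fix x :: real
    have "((\<lambda>x. exp (\<i> * (of_int m * of_real x)) / (\<i> * of_int m)) has_vector_derivative
       exp (\<i> * (of_int m * of_real x))) (at x within {-pi..pi})"
      using False by (auto intro!: derivative_eq_intros has_vector_derivative_real_field simp: field_simps)
    then show "(F has_vector_derivative cis (of_int m * x)) (at x within {-pi..pi})"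
      by (simp add: F_def[abs_def] cis_conv_exp)
  qed simp
  moreover have "F pi = F (-pi)"
    unfolding F_def cis.ctr using sin_npi_int[of m] by (simp only: mult.commute[of pi]) simp
  ultimately have "integral {-pi..pi} (\<lambda>x. cis (of_int m * x)) = 0"
    by (simp add: integral_unique)
  then show ?thesis
    using False lebesgue_integral_eq_integral[OF bounded_measurable_integrable[OF bounded_measurable_cis]]
    by simp
qed

lemma mean_square_nonneg: "mean_square h \<ge> 0"
  by (simp add: mean_square_def)

lemma mean_square_conv:
  "complex_of_real (mean_square h) = (\<integral>x. h x * cnj (h x) \<partial>lebesgue_on {-pi..pi}) / (2 * pi)"
  unfolding mean_square_def
  by (simp add: complex_norm_square[symmetric] flip: integral_complex_of_real)

lemma integrable_mean_square:
  assumes "bounded_measurable u"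
  shows "integrable (lebesgue_on {-pi..pi}) (\<lambda>x. (cmod (u x))\<^sup>2)"
proof -
  have "integrable (lebesgue_on {-pi..pi}) (\<lambda>x. Re (u x * cnj (u x)))"
    by (intro integrable_Re bounded_measurable_integrable bounded_measurable_intros assms(1))
  then show ?thesis by (simp flip: complex_norm_square)
qed

lemma mean_square_mono:
  assumes "bounded_measurable u" "bounded_measurable v" "\<And>x. c * (cmod (u x))\<^sup>2 \<le> d * (cmod (v x))\<^sup>2"
  shows "c * mean_square u \<le> d * mean_square v"
proof -
  have "(\<integral>x. c * (cmod (u x))\<^sup>2 \<partial>lebesgue_on {-pi..pi}) \<le> (\<integral>x. d * (cmod (v x))\<^sup>2 \<partial>lebesgue_on {-pi..pi})"
    using assms by (intro integral_mono) (auto intro: integrable_mean_square)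
  then show ?thesis by (simp add: mean_square_def divide_right_mono)
qed

lemma mean_square_le:
  assumes "bounded_measurable u" "\<And>x. x \<in> {-pi..pi} \<Longrightarrow> cmod (u x) \<le> e" "e \<ge> 0"
  shows "mean_square u \<le> e\<^sup>2"
proof -
  have "(\<integral>x. (cmod (u x))\<^sup>2 \<partial>lebesgue_on {-pi..pi}) \<le> (\<integral>x. e\<^sup>2 \<partial>lebesgue_on {-pi..pi})"
  proof (rule integral_mono)
    show "integrable (lebesgue_on {-pi..pi}) (\<lambda>x. (cmod (u x))\<^sup>2)"
      using assms(1) by (rule integrable_mean_square)
    show "integrable (lebesgue_on {-pi..pi}) (\<lambda>x. e\<^sup>2)"
      using finite_measure_circle by (simp add: finite_measure.integrable_const)
  qed (use assms in \<open>auto intro!: power_mono\<close>)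
  also have "\<dots> = 2 * pi * e\<^sup>2" by (simp add: measure_restrict_space)
  finally show ?thesis by (simp add: mean_square_def field_simps)
qed

lemma mean_square_add_le:
  assumes "bounded_measurable u" "bounded_measurable v"
  shows "mean_square (\<lambda>x. u x + v x) \<le> 2 * mean_square u + 2 * mean_square v"
proof -
  let ?M = "lebesgue_on {-pi..pi}"
  have "(\<integral>x. (cmod (u x + v x))\<^sup>2 \<partial>?M) \<le> (\<integral>x. 2 * (cmod (u x))\<^sup>2 + 2 * (cmod (v x))\<^sup>2 \<partial>?M)"
  proof (rule integral_mono)
    fix x
    have "(cmod (u x + v x))\<^sup>2 \<le> (cmod (u x) + cmod (v x))\<^sup>2"
      by (intro power_mono norm_triangle_ineq) simp
    also have "\<dots> \<le> 2 * (cmod (u x))\<^sup>2 + 2 * (cmod (v x))\<^sup>2"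
      using sum_squares_bound[of "cmod (u x)" "cmod (v x)"] by (simp add: power2_sum)
    finally show "(cmod (u x + v x))\<^sup>2 \<le> 2 * (cmod (u x))\<^sup>2 + 2 * (cmod (v x))\<^sup>2" .
  qed (use assms in \<open>auto intro!: integrable_mean_square bounded_measurable_add\<close>)
  also have "\<dots> = 2 * (\<integral>x. (cmod (u x))\<^sup>2 \<partial>?M) + 2 * (\<integral>x. (cmod (v x))\<^sup>2 \<partial>?M)"
    using assms by (subst Bochner_Integration.integral_add) (auto intro!: integrable_mean_square)
  finally show ?thesis by (simp add: mean_square_def field_simps)
qed

text \<open>Completing the square in the coefficients. Bessel's inequality and the optimality of the
  Fourier coefficients are the two ways of reading this identity.\<close>
lemma mean_square_minus_trig:
  assumes u: "bounded_measurable u" and S: "finite S"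
  shows "mean_square (\<lambda>x. u x - (\<Sum>m\<in>S. c m * cis (of_int m * x)))
    = mean_square u - (\<Sum>m\<in>S. (cmod (fourier_coeff u m))\<^sup>2) + (\<Sum>m\<in>S. (cmod (fourier_coeff u m - c m))\<^sup>2)"
proof -
  let ?M = "lebesgue_on {-pi..pi}"
  define q where "q x = (\<Sum>m\<in>S. c m * cis (of_int m * x))" for x
  have q: "bounded_measurable q" unfolding q_def[abs_def] by (intro bounded_measurable_intros)
  note I = bounded_measurable_integrable bounded_measurable_intros u q
  have cnj_q: "cnj (q x) = (\<Sum>m\<in>S. cnj (c m) * cis (- of_int m * x))" for x
    by (simp add: q_def cis_cnj)
  have uq: "(\<integral>x. u x * cnj (q x) \<partial>?M) = 2 * pi * (\<Sum>m\<in>S. cnj (c m) * fourier_coeff u m)"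
  proof -
    have "(\<integral>x. u x * cnj (q x) \<partial>?M) = (\<integral>x. (\<Sum>m\<in>S. cnj (c m) * (u x * cis (- of_int m * x))) \<partial>?M)"
      by (simp add: cnj_q sum_distrib_left ac_simps)
    also have "\<dots> = (\<Sum>m\<in>S. cnj (c m) * (\<integral>x. u x * cis (- of_int m * x) \<partial>?M))"
      by (subst Bochner_Integration.integral_sum) (intro I, simp)
    finally show ?thesis by (simp add: fourier_coeff_def sum_distrib_left)
  qed
  have qu: "(\<integral>x. q x * cnj (u x) \<partial>?M) = 2 * pi * (\<Sum>m\<in>S. c m * cnj (fourier_coeff u m))"
  proof -
    have "(\<integral>x. q x * cnj (u x) \<partial>?M) = cnj (\<integral>x. u x * cnj (q x) \<partial>?M)"
      by (simp add: mult.commute flip: Bochner_Integration.integral_cnj)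
    then show ?thesis by (simp add: uq)
  qed
  have qq: "(\<integral>x. q x * cnj (q x) \<partial>?M) = 2 * pi * (\<Sum>m\<in>S. c m * cnj (c m))"
  proof -
    have "(\<integral>x. q x * cnj (q x) \<partial>?M)
      = (\<integral>x. (\<Sum>k\<in>S. \<Sum>m\<in>S. c k * cnj (c m) * cis (of_int (k - m) * x)) \<partial>?M)"
      unfolding cnj_q by (simp add: q_def sum_product cis_mult algebra_simps)
    also have "\<dots> = (\<Sum>k\<in>S. \<Sum>m\<in>S. c k * cnj (c m) * (\<integral>x. cis (of_int (k - m) * x) \<partial>?M))"
      by (subst Bochner_Integration.integral_sum, intro I, subst Bochner_Integration.integral_sum, intro I)
         simp
    also have "\<dots> = (\<Sum>k\<in>S. \<Sum>m\<in>S. if k = m then 2 * pi * (c k * cnj (c k)) else 0)"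
      unfolding integral_cis by (intro sum.cong refl) auto
    finally show ?thesis using S by (simp add: sum_distrib_left)
  qed
  have cancel: "a = b - r - s + t" if "a * k = b * k - k * r - k * s + k * t" "k \<noteq> 0" for a b r s t k :: complex
  proof -
    have "k * (a - (b - r - s + t)) = 0" using that(1) by (simp add: algebra_simps)
    then show ?thesis using that(2) by simp
  qed
  have "complex_of_real (mean_square (\<lambda>x. u x - q x)) * (2 * pi)
     = (\<integral>x. u x * cnj (u x) - u x * cnj (q x) - q x * cnj (u x) + q x * cnj (q x) \<partial>?M)"
    by (subst mean_square_conv) (simp add: algebra_simps)
  also have "\<dots> = (\<integral>x. u x * cnj (u x) \<partial>?M) - (\<integral>x. u x * cnj (q x) \<partial>?M)
      - (\<integral>x. q x * cnj (u x) \<partial>?M) + (\<integral>x. q x * cnj (q x) \<partial>?M)"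
    by (subst Bochner_Integration.integral_add Bochner_Integration.integral_diff; (intro I)?)+ simp
  also have "(\<integral>x. u x * cnj (u x) \<partial>?M) = complex_of_real (mean_square u) * (2 * pi)"
    by (subst mean_square_conv) simp
  finally have "complex_of_real (mean_square (\<lambda>x. u x - q x)) =
     mean_square u - (\<Sum>m\<in>S. cnj (c m) * fourier_coeff u m)
       - (\<Sum>m\<in>S. c m * cnj (fourier_coeff u m)) + (\<Sum>m\<in>S. c m * cnj (c m))"
    unfolding uq qu qq by (rule cancel) simp
  also have "\<dots> = complex_of_real (mean_square u - (\<Sum>m\<in>S. (cmod (fourier_coeff u m))\<^sup>2)
     + (\<Sum>m\<in>S. (cmod (fourier_coeff u m - c m))\<^sup>2))"
    by (simp add: complex_norm_square algebra_simps sum.distrib sum_subtractf del: of_real_power)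
  finally show ?thesis unfolding q_def of_real_eq_iff .
qed

lemma bessel_inequality:
  assumes "bounded_measurable u" "finite S"
  shows "(\<Sum>m\<in>S. (cmod (fourier_coeff u m))\<^sup>2) \<le> mean_square u"
  using mean_square_minus_trig[OF assms, of "fourier_coeff u"]
    mean_square_nonneg[of "\<lambda>x. u x - (\<Sum>m\<in>S. fourier_coeff u m * cis (of_int m * x))"] by simp

lemma best_approximation:
  assumes "bounded_measurable u" "finite S"
  shows "mean_square u - (\<Sum>m\<in>S. (cmod (fourier_coeff u m))\<^sup>2)
    \<le> mean_square (\<lambda>x. u x - (\<Sum>m\<in>S. c m * cis (of_int m * x)))"
  unfolding mean_square_minus_trig[OF assms] by (simp add: sum_nonneg)

lemma mean_square_trig:
  assumes "finite S"
  shows "mean_square (\<lambda>x. \<Sum>m\<in>S. c m * cis (of_int m * x)) = (\<Sum>m\<in>S. (cmod (c m))\<^sup>2)"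
  using mean_square_minus_trig[OF bounded_measurable_const[of 0] assms, of c]
  by (simp add: mean_square_def fourier_coeff_def)

section \<open>Trigonometric polynomials are dense in mean square\<close>

lemma trig_polynomialI:
  assumes "finite S" "\<And>x. h x = (\<Sum>m\<in>S. c m * cis (of_int m * x))"
  shows "trig_polynomial h"
proof -
  obtain N :: nat where "\<forall>k\<in>(\<lambda>m. nat \<bar>m\<bar>) ` S. k \<le> N"
    using finite_nat_set_iff_bounded_le[of "(\<lambda>m. nat \<bar>m\<bar>) ` S"] assms(1) by blast
  then have N: "\<forall>m\<in>S. \<bar>m\<bar> \<le> int N" by fastforce
  have "h x = (\<Sum>k\<in>{- int N..int N}. (if k \<in> S then c k else 0) * exp (\<i> * of_int k * of_real x))" for x
  proof -
    have "(\<Sum>k\<in>{- int N..int N}. (if k \<in> S then c k else 0) * exp (\<i> * of_int k * of_real x))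
      = (\<Sum>k\<in>S. (if k \<in> S then c k else 0) * exp (\<i> * of_int k * of_real x))"
      using N by (intro sum.mono_neutral_right) force+
    also have "\<dots> = h x"
      unfolding assms(2) by (intro sum.cong) (simp_all add: cis_conv_exp mult.assoc)
    finally show ?thesis ..
  qed
  then show ?thesis
    unfolding trig_polynomial_def by (intro exI[of _ N] exI[of _ "\<lambda>k. if k \<in> S then c k else 0"]) blast
qed

lemma trig_polynomialE:
  assumes "trig_polynomial h"
  obtains N c where "\<And>x. h x = (\<Sum>m\<in>{- int N..int N}. c m * cis (of_int m * x))"
proof -
  obtain N c where "\<forall>x. h x = (\<Sum>k\<in>{- int N..int N}. c k * exp (\<i> * of_int k * of_real x))"
    using assms unfolding trig_polynomial_def by blast
  then have "h x = (\<Sum>m\<in>{- int N..int N}. c m * cis (of_int m * x))" for x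
    by (simp add: cis_conv_exp mult.assoc)
  then show thesis by (rule that)
qed

lemma trig_polynomial_monomial: "trig_polynomial (\<lambda>x. c * cis (of_int m * x))"
  by (rule trig_polynomialI[of "{m}" _ "\<lambda>_. c"]) simp_all

lemma trig_polynomial_const: "trig_polynomial (\<lambda>_. c)"
  using trig_polynomial_monomial[of c 0] by simp

lemma trig_polynomial_add:
  assumes "trig_polynomial u" "trig_polynomial v"
  shows "trig_polynomial (\<lambda>x. u x + v x)"
proof -
  obtain N c where c: "\<And>x. u x = (\<Sum>m\<in>{- int N..int N}. c m * cis (of_int m * x))"
    by (rule trig_polynomialE[OF assms(1)]) blast
  obtain K d where d: "\<And>x. v x = (\<Sum>m\<in>{- int K..int K}. d m * cis (of_int m * x))"
    by (rule trig_polynomialE[OF assms(2)]) blast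
  let ?S = "{- int N..int N} \<union> {- int K..int K}"
  show ?thesis
  proof (rule trig_polynomialI)
    fix x
    have "u x = (\<Sum>m\<in>?S. (if m \<in> {- int N..int N} then c m else 0) * cis (of_int m * x))"
      unfolding c by (rule sum.mono_neutral_cong_left) auto
    moreover have "v x = (\<Sum>m\<in>?S. (if m \<in> {- int K..int K} then d m else 0) * cis (of_int m * x))"
      unfolding d by (rule sum.mono_neutral_cong_left) auto
    ultimately show "u x + v x = (\<Sum>m\<in>?S. ((if m \<in> {- int N..int N} then c m else 0)
        + (if m \<in> {- int K..int K} then d m else 0)) * cis (of_int m * x))"
      by (simp only: distrib_right sum.distrib)
  qed simp
qed

lemma trig_polynomial_sum:
  "(\<And>i. i \<in> I \<Longrightarrow> trig_polynomial (u i)) \<Longrightarrow> trig_polynomial (\<lambda>x. \<Sum>i\<in>I. u i x)"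
  by (induction I rule: infinite_finite_induct)
     (auto intro: trig_polynomial_add trig_polynomial_const)

lemma trig_polynomial_mult:
  assumes "trig_polynomial u" "trig_polynomial v"
  shows "trig_polynomial (\<lambda>x. u x * v x)"
proof -
  obtain N c where c: "\<And>x. u x = (\<Sum>m\<in>{- int N..int N}. c m * cis (of_int m * x))"
    by (rule trig_polynomialE[OF assms(1)]) blast
  obtain K d where d: "\<And>x. v x = (\<Sum>m\<in>{- int K..int K}. d m * cis (of_int m * x))"
    by (rule trig_polynomialE[OF assms(2)]) blast
  have "u x * v x = (\<Sum>m\<in>{- int N..int N}. \<Sum>k\<in>{- int K..int K}. (c m * d k) * cis (of_int (m + k) * x))" for x
    unfolding c d sum_product by (simp add: distrib_right flip: cis_mult) (simp add: ac_simps)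
  then show ?thesis
    by (simp only:) (intro trig_polynomial_sum trig_polynomial_monomial)
qed

lemma trig_polynomial_bounded_measurable:
  assumes "trig_polynomial u"
  shows "bounded_measurable u"
proof -
  obtain N c where c: "\<And>x. u x = (\<Sum>m\<in>{- int N..int N}. c m * cis (of_int m * x))"
    by (rule trig_polynomialE[OF assms]) blast
  then have "u = (\<lambda>x. \<Sum>m\<in>{- int N..int N}. c m * cis (of_int m * x))" by blast
  then show ?thesis by (simp only:) (intro bounded_measurable_intros)
qed

lemma trig_polynomial_real_polynomial_function:
  assumes "real_polynomial_function r"
  shows "trig_polynomial (\<lambda>x. complex_of_real (r (cis x)))"
  using assms
proof (induction rule: real_polynomial_function.induct)
  case (linear f)
  interpret bounded_linear f by fact
  have "f (cis x) = cos x * f 1 + sin x * f \<i>" for x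
  proof -
    have "cis x = cos x *\<^sub>R 1 + sin x *\<^sub>R \<i>" by (simp add: complex_eq_iff)
    then show ?thesis by (simp only: add scaleR) simp
  qed
  moreover have "complex_of_real (cos x) = 1/2 * cis (of_int 1 * x) + 1/2 * cis (of_int (-1) * x)"
    "complex_of_real (sin x) = -\<i>/2 * cis (of_int 1 * x) + \<i>/2 * cis (of_int (-1) * x)" for x
    by (simp_all add: complex_eq_iff)
  ultimately have "complex_of_real (f (cis x)) =
     (1/2 * cis (of_int 1 * x) + 1/2 * cis (of_int (-1) * x)) * f 1 +
     (-\<i>/2 * cis (of_int 1 * x) + \<i>/2 * cis (of_int (-1) * x)) * f \<i>" for x
    by (simp only: of_real_add of_real_mult)
  then show ?case
    by (simp only:) (intro trig_polynomial_add trig_polynomial_mult trig_polynomial_monomial trig_polynomial_const)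
qed (auto intro: trig_polynomial_const trig_polynomial_add trig_polynomial_mult)

lemma trig_polynomial_polynomial_function:
  fixes q :: "complex \<Rightarrow> complex"
  assumes "polynomial_function q"
  shows "trig_polynomial (\<lambda>x. q (cis x))"
proof -
  have "real_polynomial_function (Re \<circ> q)" "real_polynomial_function (Im \<circ> q)"
    using assms bounded_linear_Re bounded_linear_Im unfolding polynomial_function_def by blast+
  then have "trig_polynomial (\<lambda>x. complex_of_real ((Re \<circ> q) (cis x)) + \<i> * complex_of_real ((Im \<circ> q) (cis x)))"
    by (intro trig_polynomial_add trig_polynomial_mult trig_polynomial_const
        trig_polynomial_real_polynomial_function)
  then show ?thesis by (simp flip: complex_eq)
qed

text \<open>The polynomial version of the Stone-Weierstrass theorem, applied on the unit circle to
  \<open>z \<mapsto> h (Arg z)\<close>. The argument jumps at \<open>-1\<close>; this does no harm because \<open>h\<close> vanishes near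
  \<open>\<plusminus>\<pi>\<close>.\<close>
lemma trig_polynomial_uniform_approx:
  fixes h :: "real \<Rightarrow> complex"
  assumes h: "continuous_on UNIV h" and d: "0 < d" "d < pi"
    and supp: "\<And>x. pi - d \<le> \<bar>x\<bar> \<Longrightarrow> h x = 0" and e: "e > 0"
  obtains q where "trig_polynomial q" "\<And>x. x \<in> {-pi..pi} \<Longrightarrow> cmod (h x - q x) < e"
proof -
  have "continuous_on (sphere 0 1) (\<lambda>z. h (Arg z))"
    unfolding continuous_on_eq_continuous_within
  proof
    fix z :: complex assume z: "z \<in> sphere 0 1"
    show "continuous (at z within sphere 0 1) (\<lambda>z. h (Arg z))"
    proof (cases "z = -1")
      case False
      have "z \<notin> \<real>\<^sub>\<le>\<^sub>0"
        using z False by (auto simp: complex_nonpos_Reals_iff complex_eq_iff cmod_eq_Re)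
      then have "continuous (at z within sphere 0 1) Arg" by (rule continuous_within_Arg)
      then have "(Arg \<longlongrightarrow> Arg z) (at z within sphere 0 1)" by (simp add: continuous_within)
      moreover have "isCont h (Arg z)" using h by (simp add: continuous_on_eq_continuous_at)
      ultimately have "((\<lambda>z. h (Arg z)) \<longlongrightarrow> h (Arg z)) (at z within sphere 0 1)"
        by (rule isCont_tendsto_compose[rotated])
      then show ?thesis by (simp add: continuous_within)
    next
      case True
      have zero: "h (Arg w) = 0" if "w \<in> sphere 0 1" "Re w < cos (pi - d)" for w
      proof (rule supp, rule ccontr)
        assume "\<not> pi - d \<le> \<bar>Arg w\<bar>"
        then have "cos (pi - d) < cos \<bar>Arg w\<bar>" using d by (intro cos_monotone_0_pi) auto
        also have "\<dots> = Re w"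
        proof -
          have "w = cis (Arg w)" using that(1) complex_norm_eq_1_exp_eq[of w] by (simp add: cis_conv_exp)
          then have "Re w = Re (cis (Arg w))" by simp
          then show ?thesis by simp
        qed
        finally show False using that by simp
      qed
      have "cos d < 1" using d cos_monotone_0_pi[of 0 d] by simp
      then have m1: "Re (-1) < cos (pi - d)" by simp
      have "open {w. Re w < cos (pi - d)}" by (rule open_halfspace_Re_lt)
      then have "eventually (\<lambda>w. h (Arg w) = 0) (at z within sphere 0 1)"
        unfolding eventually_at_topological True using zero m1 by blast
      moreover have "h (Arg z) = 0" using zero[of "-1"] m1 True by simp
      ultimately show ?thesis
        unfolding continuous_within by (simp add: tendsto_eventually)
    qed
  qed
  then obtain q where q: "polynomial_function q" "\<And>z. z \<in> sphere 0 1 \<Longrightarrow> cmod (h (Arg z) - q z) < e"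
    using Stone_Weierstrass_polynomial_function[of "sphere 0 1" "\<lambda>z. h (Arg z)" e] e by auto
  show thesis
  proof (rule that)
    show "trig_polynomial (\<lambda>x. q (cis x))" using q(1) by (rule trig_polynomial_polynomial_function)
    fix x assume x: "x \<in> {-pi..pi}"
    have "h (Arg (cis x)) = h x"
    proof (cases "x = -pi")
      case True
      have "Arg (cis x) = pi" unfolding True by (simp add: cis.ctr Arg_eq_pi complex_eq_iff)
      then show ?thesis using supp[of pi] supp[of "-pi"] d True by simp
    next
      case False
      then show ?thesis using x by (simp add: Arg_cis)
    qed
    then show "cmod (h x - q (cis x)) < e" using q(2)[of "cis x"] by simp
  qed
qed

text \<open>A measurable function is almost everywhere a limit of continuous ones. Truncating these at the
  bound \<open>C\<close> of \<open>g\<close> makes dominated convergence applicable, and multiplying by cutoff functions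
  that increase to \<open>1\<close> on the open interval makes them vanish near \<open>\<plusminus>\<pi>\<close>.\<close>
lemma continuous_mean_square_approx:
  assumes g: "bounded_measurable g" and e: "e > 0"
  obtains h d where "continuous_on UNIV h" "0 < d" "d < pi" "\<And>x. pi - d \<le> \<bar>x\<bar> \<Longrightarrow> h x = 0"
    "bounded_measurable h" "mean_square (\<lambda>x. g x - h x) < e"
proof -
  let ?M = "lebesgue_on {-pi..pi}"
  obtain C where C: "C > 0" "\<And>x. cmod (g x) \<le> C"
    using g unfolding bounded_measurable_def bounded_pos by auto
  have "g measurable_on {-pi..pi}"
    using g by (simp add: measurable_on_iff_borel_measurable bounded_measurable_def)
  then obtain N k where N: "negligible N" and k: "\<And>n. continuous_on UNIV (k n)"
    and lim: "\<And>x. x \<notin> N \<Longrightarrow> (\<lambda>n. k n x) \<longlonglongrightarrow> (if x \<in> {-pi..pi} then g x else 0)"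
    unfolding measurable_on_def by blast
  define trunc where "trunc z = complex_of_real (C / max C (cmod z)) * z" for z
  have trunc_cont: "continuous_on UNIV trunc"
    unfolding trunc_def[abs_def] using C(1) by (intro continuous_intros) auto
  have trunc_le: "cmod (trunc z) \<le> C" for z
    using C(1) by (simp add: trunc_def norm_mult norm_divide field_simps max_def)
  define cut where "cut n x = max 0 (min 1 (real n * (pi - \<bar>x\<bar>) - 1))" for n :: nat and x
  define h where "h n x = complex_of_real (cut n x) * trunc (k n x)" for n x
  have cut_cont: "continuous_on UNIV (cut n)" for n
    unfolding cut_def[abs_def] by (intro continuous_intros)
  have h_cont: "continuous_on UNIV (h n)" for n
    unfolding h_def[abs_def]
    using cut_cont k trunc_cont by (intro continuous_intros continuous_on_compose2[OF trunc_cont]) auto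
  have h_le: "cmod (h n x) \<le> C" for n x
  proof -
    have "cut n x \<le> 1" "cut n x \<ge> 0" by (auto simp: cut_def)
    then have "cut n x * cmod (trunc (k n x)) \<le> 1 * C"
      using trunc_le by (intro mult_mono) auto
    then show ?thesis using \<open>cut n x \<ge> 0\<close> by (simp add: h_def norm_mult)
  qed
  have h_bm: "bounded_measurable (h n)" for n
    unfolding bounded_measurable_def
    using h_le continuous_on_subset[OF h_cont]
    by (auto intro!: boundedI continuous_imp_measurable_on_sets_lebesgue)
  have h_lim: "(\<lambda>n. h n x) \<longlonglongrightarrow> g x" if "x \<notin> N" "\<bar>x\<bar> < pi" for x
  proof -
    have "x \<in> {-pi..pi}" using that by auto
    with lim[OF that(1)] have "(\<lambda>n. k n x) \<longlonglongrightarrow> g x" by simp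
    then have "(\<lambda>n. trunc (k n x)) \<longlonglongrightarrow> trunc (g x)"
      by (intro continuous_on_tendsto_compose[OF trunc_cont]) auto
    also have "trunc (g x) = g x" using C(1) C(2)[of x] by (simp add: trunc_def max_def)
    finally have *: "(\<lambda>n. trunc (k n x)) \<longlonglongrightarrow> g x" .
    obtain n0 :: nat where n0: "2 / (pi - \<bar>x\<bar>) < n0" using reals_Archimedean2 by blast
    have "eventually (\<lambda>n. h n x = trunc (k n x)) sequentially"
      using eventually_ge_at_top[of n0]
    proof eventually_elim
      case (elim n)
      have "2 < n0 * (pi - \<bar>x\<bar>)" using n0 that by (simp add: field_simps)
      also have "\<dots> \<le> n * (pi - \<bar>x\<bar>)" using elim that by (intro mult_right_mono) auto
      finally have "cut n x = 1" by (simp add: cut_def)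
      then show ?case by (simp add: h_def)
    qed
    then show ?thesis using * by (simp add: tendsto_cong)
  qed
  have null: "AE x in ?M. x \<notin> N \<and> \<bar>x\<bar> < pi"
  proof -
    have "negligible (N \<union> {-pi, pi})" using N by (simp add: negligible_Un_eq)
    then have "N \<union> {-pi, pi} \<in> null_sets lebesgue" by (simp add: negligible_iff_null_sets)
    then have "AE x in lebesgue. x \<notin> N \<union> {-pi, pi}" by (rule AE_not_in)
    then have "AE x in lebesgue. x \<in> {-pi..pi} \<longrightarrow> x \<notin> N \<and> \<bar>x\<bar> < pi"
      by (rule eventually_mono) auto
    then show ?thesis by (subst AE_restrict_space_iff) auto
  qed
  have "(\<lambda>n. \<integral>x. (cmod (g x - h n x))\<^sup>2 \<partial>?M) \<longlonglongrightarrow> (\<integral>x. 0 \<partial>?M)"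
  proof (rule integral_dominated_convergence[where w = "\<lambda>_. (2 * C)\<^sup>2"])
    show "integrable ?M (\<lambda>_. (2 * C)\<^sup>2)"
      using finite_measure_circle by (rule finite_measure.integrable_const)
    show "(\<lambda>x. (cmod (g x - h n x))\<^sup>2) \<in> borel_measurable ?M" for n
      using g h_bm by (intro borel_measurable_integrable integrable_mean_square bounded_measurable_diff)
    show "AE x in ?M. (\<lambda>n. (cmod (g x - h n x))\<^sup>2) \<longlonglongrightarrow> 0"
      using null
    proof eventually_elim
      case (elim x)
      have "(\<lambda>n. (cmod (g x - h n x))\<^sup>2) \<longlonglongrightarrow> (cmod (g x - g x))\<^sup>2"
        using h_lim[of x] elim by (intro tendsto_intros) auto
      then show ?case by simp
    qed
    show "AE x in ?M. norm ((cmod (g x - h n x))\<^sup>2) \<le> (2 * C)\<^sup>2" for n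
    proof (rule AE_I2)
      fix x
      have "cmod (g x - h n x) \<le> 2 * C"
        using norm_triangle_ineq4[of "g x" "h n x"] C(2)[of x] h_le[of n x] by linarith
      then show "norm ((cmod (g x - h n x))\<^sup>2) \<le> (2 * C)\<^sup>2"
        using power_mono[of "cmod (g x - h n x)" "2 * C" 2] by simp
    qed
  qed simp
  then have "(\<lambda>n. mean_square (\<lambda>x. g x - h n x)) \<longlonglongrightarrow> 0"
    unfolding mean_square_def by (auto intro: tendsto_divide_zero)
  then have "eventually (\<lambda>n. mean_square (\<lambda>x. g x - h n x) < e) sequentially"
    using e by (rule order_tendstoD)
  moreover have "eventually (\<lambda>n. n \<ge> (1::nat)) sequentially" by (rule eventually_ge_at_top)
  ultimately have "eventually (\<lambda>n. n \<ge> 1 \<and> mean_square (\<lambda>x. g x - h n x) < e) sequentially"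
    by eventually_elim auto
  then obtain n where n: "n \<ge> 1" "mean_square (\<lambda>x. g x - h n x) < e"
    using eventually_happens'[OF sequentially_bot] by blast
  show thesis
  proof (rule that[of "h n" "1 / n"])
    have "1 / real n \<le> 1" using n by simp
    then show "1 / real n < pi" using pi_gt3 by linarith
    fix x assume "pi - 1 / real n \<le> \<bar>x\<bar>"
    then have "real n * (pi - \<bar>x\<bar>) \<le> real n * (1 / n)" by (intro mult_left_mono) auto
    then have "cut n x = 0" using n by (simp add: cut_def)
    then show "h n x = 0" by (simp add: h_def)
  qed (use n h_cont h_bm in auto)
qed

text \<open>The nontrivial half of Parseval's identity: any approximating trigonometric polynomial is beaten
  by the partial Fourier sum of the same degree.\<close>
lemma parseval_approx:
  assumes g: "bounded_measurable g" and e: "e > 0"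
  obtains L :: nat where "mean_square g - (\<Sum>m\<in>{- int L..int L}. (cmod (fourier_coeff g m))\<^sup>2) < e"
proof -
  obtain h d where h: "continuous_on UNIV h" "0 < d" "d < pi" "\<And>x. pi - d \<le> \<bar>x\<bar> \<Longrightarrow> h x = 0"
    "bounded_measurable h" "mean_square (\<lambda>x. g x - h x) < e / 4"
    using continuous_mean_square_approx[OF g, of "e / 4"] e by auto
  obtain q where q: "trig_polynomial q" "\<And>x. x \<in> {-pi..pi} \<Longrightarrow> cmod (h x - q x) < sqrt (e / 4)"
    using trig_polynomial_uniform_approx[OF h(1-4), of "sqrt (e / 4)"] e by auto
  obtain L c where c: "\<And>x. q x = (\<Sum>m\<in>{- int L..int L}. c m * cis (of_int m * x))"
    by (rule trig_polynomialE[OF q(1)]) blast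
  have qb: "bounded_measurable q" using q(1) by (rule trig_polynomial_bounded_measurable)
  have "mean_square (\<lambda>x. h x - q x) \<le> (sqrt (e / 4))\<^sup>2"
    using q(2) e by (intro mean_square_le bounded_measurable_diff h(5) qb) (auto intro: less_imp_le)
  then have hq: "mean_square (\<lambda>x. h x - q x) \<le> e / 4" using e by simp
  have "mean_square g - (\<Sum>m\<in>{- int L..int L}. (cmod (fourier_coeff g m))\<^sup>2) \<le> mean_square (\<lambda>x. g x - q x)"
    unfolding c by (rule best_approximation[OF g]) simp
  also have "\<dots> = mean_square (\<lambda>x. (g x - h x) + (h x - q x))" by simp
  also have "\<dots> \<le> 2 * mean_square (\<lambda>x. g x - h x) + 2 * mean_square (\<lambda>x. h x - q x)"
    by (intro mean_square_add_le bounded_measurable_diff g h(5) qb)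
  also have "\<dots> < e" using h(6) hq by simp
  finally show thesis by (rule that)
qed

text \<open>Column \<open>k\<close> of the Toeplitz matrix contains the Fourier coefficients with indices from \<open>-k\<close> to
  \<open>n - 1 - k\<close>. For all but boundedly many \<open>k\<close> this range contains \<open>[-L, L]\<close>, which
  carries almost all of the mean square of \<open>g\<close>.\<close>
lemma toeplitz_defect_tendsto:
  assumes g: "bounded_measurable g"
  shows "(\<lambda>n. (n * mean_square g - (\<Sum>k<n. \<Sum>j<n. (cmod (fourier_coeff g (int j - int k)))\<^sup>2)) / n) \<longlonglongrightarrow> 0"
proof -
  define a where "a m = (cmod (fourier_coeff g m))\<^sup>2" for m
  define D where "D n = n * mean_square g - (\<Sum>k<n. \<Sum>j<n. a (int j - int k))" for n :: nat
  have shift: "(\<Sum>j<n. a (int j - int k)) = (\<Sum>m\<in>(\<lambda>j. int j - int k) ` {..<n}. a m)" for n k :: nat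
    by (subst sum.reindex) (auto simp: inj_on_def)
  have col_le: "(\<Sum>j<n. a (int j - int k)) \<le> mean_square g" for n k :: nat
    unfolding shift unfolding a_def by (rule bessel_inequality[OF g]) simp
  have D_eq: "D n = (\<Sum>k<n. mean_square g - (\<Sum>j<n. a (int j - int k)))" for n
    by (simp add: D_def sum_subtractf)
  have D_nonneg: "D n \<ge> 0" for n
    unfolding D_eq using col_le by (intro sum_nonneg) simp
  have "(\<lambda>n. D n / n) \<longlonglongrightarrow> 0"
  proof (rule LIMSEQ_I)
    fix r :: real assume r: "r > 0"
    obtain L where L: "mean_square g - (\<Sum>m\<in>{- int L..int L}. a m) < r / 2"
      using parseval_approx[OF g, of "r / 2"] r unfolding a_def by auto
    have bound: "D n \<le> n * (r / 2) + 2 * L * mean_square g" for n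
    proof -
      have "D n \<le> (\<Sum>k<n. r / 2 + (if L \<le> k \<and> k + L < n then 0 else mean_square g))"
        unfolding D_eq
      proof (rule sum_mono)
        fix k assume k: "k \<in> {..<n}"
        show "mean_square g - (\<Sum>j<n. a (int j - int k))
           \<le> r / 2 + (if L \<le> k \<and> k + L < n then 0 else mean_square g)"
        proof (cases "L \<le> k \<and> k + L < n")
          case True
          have "(\<Sum>m\<in>{- int L..int L}. a m) \<le> (\<Sum>m\<in>(\<lambda>j. int j - int k) ` {..<n}. a m)"
          proof (rule sum_mono2)
            show "{- int L..int L} \<subseteq> (\<lambda>j. int j - int k) ` {..<n}"
            proof
              fix m assume "m \<in> {- int L..int L}"
              then have "m = int (nat (m + int k)) - int k" "nat (m + int k) < n" using True by auto
              then show "m \<in> (\<lambda>j. int j - int k) ` {..<n}" by blast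
            qed
          qed (auto simp: a_def)
          then show ?thesis using L True shift[where n = n and k = k] by simp
        next
          case False
          have "0 \<le> (\<Sum>j<n. a (int j - int k))" by (intro sum_nonneg) (simp add: a_def)
          then show ?thesis unfolding if_not_P[OF False] using r by simp
        qed
      qed
      also have "\<dots> = n * (r / 2) + (\<Sum>k\<in>{k\<in>{..<n}. \<not> (L \<le> k \<and> k + L < n)}. mean_square g)"
        unfolding sum.distrib sum.inter_filter[OF finite_lessThan]
        by (simp, intro sum.cong) auto
      also have "\<dots> \<le> n * (r / 2) + real (2 * L) * mean_square g"
      proof -
        have "card {k\<in>{..<n}. \<not> (L \<le> k \<and> k + L < n)} \<le> card ({..<L} \<union> {n - L..<n})"
          by (rule card_mono) auto
        also have "\<dots> \<le> card {..<L} + card {n - L..<n}" by (rule card_Un_le)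
        also have "\<dots> \<le> 2 * L" by simp
        finally show ?thesis
          using mean_square_nonneg[of g] by (simp only: sum_constant) (intro add_left_mono mult_right_mono, simp_all)
      qed
      finally show ?thesis by simp
    qed
    obtain n0 :: nat where n0: "2 * (2 * L * mean_square g) / r < n0" using reals_Archimedean2 by blast
    show "\<exists>n0. \<forall>n\<ge>n0. norm (D n / n - 0) < r"
    proof (intro exI[of _ "Suc n0"] allI impI)
      fix n assume n: "n \<ge> Suc n0"
      have "2 * (2 * L * mean_square g) < n0 * r" using n0 r by (simp add: field_simps)
      also have "\<dots> \<le> n * r" using n r by (intro mult_right_mono) auto
      finally have "D n < n * r" using bound[of n] by simp
      then show "norm (D n / n - 0) < r" using D_nonneg[of n] n by (simp add: field_simps)
    qed
  qed
  then show ?thesis by (simp add: D_def a_def)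
qed

section \<open>Toeplitz matrices\<close>

lemma toeplitz_carrier [simp]: "toeplitz h n \<in> carrier_mat n n"
  "dim_row (toeplitz h n) = n" "dim_col (toeplitz h n) = n"
  by (simp_all add: toeplitz_def)

lemma toeplitz_index:
  assumes "j < n" "k < n"
  shows "toeplitz h n $$ (j, k) = fourier_coeff h (int j - int k)"
proof -
  have "set_lebesgue_integral lebesgue {-pi..pi}
      (\<lambda>x. h x * exp (- \<i> * of_int (int j - int k) * of_real x))
    = (\<integral>x. h x * exp (- \<i> * of_int (int j - int k) * of_real x) \<partial>lebesgue_on {-pi..pi})"
    unfolding set_lebesgue_integral_def by (subst integral_restrict_space) simp_all
  also have "\<dots> = (\<integral>x. h x * cis (- of_int (int j - int k) * x) \<partial>lebesgue_on {-pi..pi})"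
    by (simp add: cis_conv_exp algebra_simps)
  finally show ?thesis
    using assms by (simp add: toeplitz_def fourier_coeff_def)
qed

text \<open>This identifies vectors of dimension \<open>n\<close>, isometrically by \<open>mean_square_vec_poly\<close>, with the
  trigonometric polynomials with frequencies \<open>0, \<dots>, n - 1\<close>.\<close>
definition vec_poly :: "complex vec \<Rightarrow> real \<Rightarrow> complex" where
  "vec_poly v x = (\<Sum>k<dim_vec v. v $ k * cis (of_int (int k) * x))"

lemma bounded_measurable_vec_poly: "bounded_measurable (vec_poly v)"
  unfolding vec_poly_def[abs_def] by (intro bounded_measurable_intros)

lemma mean_square_vec_poly: "mean_square (vec_poly v) = sqnorm v"
proof -
  have "vec_poly v = (\<lambda>x. \<Sum>m\<in>int ` {..<dim_vec v}. v $ nat m * cis (of_int m * x))"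
    by (simp add: vec_poly_def[abs_def] sum.reindex)
  then show ?thesis by (simp only: mean_square_trig[of "int ` {..<dim_vec v}"] finite_imageI finite_lessThan)
    (simp add: sum.reindex sqnorm_def)
qed

lemma fourier_coeff_mult_trig:
  assumes g: "bounded_measurable g"
  shows "fourier_coeff (\<lambda>x. g x * (\<Sum>i\<in>I. c i * cis (of_int (m i) * x))) j
    = (\<Sum>i\<in>I. c i * fourier_coeff g (j - m i))"
proof -
  let ?M = "lebesgue_on {-pi..pi}"
  have "(\<integral>x. g x * (\<Sum>i\<in>I. c i * cis (of_int (m i) * x)) * cis (- of_int j * x) \<partial>?M)
     = (\<integral>x. (\<Sum>i\<in>I. c i * (g x * cis (- of_int (j - m i) * x))) \<partial>?M)"
  proof (rule arg_cong[of _ _ "integral\<^sup>L ?M"], rule ext)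
    fix x
    have "cis (of_int (m i) * x) * cis (- of_int j * x) = cis (- of_int (j - m i) * x)" for i
      by (simp add: cis_mult algebra_simps)
    then show "g x * (\<Sum>i\<in>I. c i * cis (of_int (m i) * x)) * cis (- of_int j * x)
      = (\<Sum>i\<in>I. c i * (g x * cis (- of_int (j - m i) * x)))"
      unfolding sum_distrib_left sum_distrib_right by (intro sum.cong refl) (metis mult.assoc mult.left_commute)
  qed
  also have "\<dots> = (\<Sum>i\<in>I. c i * (\<integral>x. g x * cis (- of_int (j - m i) * x) \<partial>?M))"
    by (subst Bochner_Integration.integral_sum)
       (intro bounded_measurable_integrable bounded_measurable_intros g, simp)
  finally show ?thesis by (simp add: fourier_coeff_def sum_divide_distrib)
qed

lemma toeplitz_mult_vec_index:
  assumes "bounded_measurable g" "v \<in> carrier_vec n" "j < n"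
  shows "(toeplitz g n *\<^sub>v v) $ j = fourier_coeff (\<lambda>x. g x * vec_poly v x) (int j)"
proof -
  have "(toeplitz g n *\<^sub>v v) $ j = (\<Sum>k<n. v $ k * fourier_coeff g (int j - int k))"
    using assms by (simp add: scalar_prod_def atLeast0LessThan toeplitz_index mult.commute)
  then show ?thesis
    using assms unfolding vec_poly_def fourier_coeff_mult_trig[OF assms(1)] by simp
qed

text \<open>The Toeplitz matrix is the compression of multiplication by \<open>g\<close> to the span of the frequencies
  \<open>0, \<dots>, n - 1\<close>: its action on \<open>v\<close> reads off the corresponding Fourier coefficients of \<open>g\<close>
  times the polynomial of \<open>v\<close>, so Bessel's inequality applies.\<close>
lemma sqnorm_toeplitz_le:
  assumes g: "bounded_measurable g" and v: "v \<in> carrier_vec n"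
  shows "sqnorm (toeplitz g n *\<^sub>v v) \<le> mean_square (\<lambda>x. g x * vec_poly v x)"
proof -
  have "sqnorm (toeplitz g n *\<^sub>v v) = (\<Sum>j<n. (cmod (fourier_coeff (\<lambda>x. g x * vec_poly v x) (int j)))\<^sup>2)"
    unfolding sqnorm_def using assms by (simp add: toeplitz_mult_vec_index del: index_mult_mat_vec)
  also have "\<dots> = (\<Sum>m\<in>int ` {..<n}. (cmod (fourier_coeff (\<lambda>x. g x * vec_poly v x) m))\<^sup>2)"
    by (simp add: sum.reindex)
  also have "\<dots> \<le> mean_square (\<lambda>x. g x * vec_poly v x)"
    by (intro bessel_inequality bounded_measurable_mult g bounded_measurable_vec_poly) simp
  finally show ?thesis .
qed

text \<open>The loss in the inequality \<open>sqnorm_toeplitz_le\<close> is a Hermitian form in \<open>v\<close>, so its sum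
  over an orthonormal basis is its trace and does not depend on the basis. Both parts of the form are evaluated by
  applying Parseval's identity for the basis \<open>b\<close> to suitable vectors.\<close>
lemma toeplitz_defect_trace:
  assumes g: "bounded_measurable g" and b: "\<And>i. i < n \<Longrightarrow> b i \<in> carrier_vec n"
    and parseval: "\<And>v. v \<in> carrier_vec n \<Longrightarrow> sqnorm v = (\<Sum>i<n. (cmod (v \<bullet>c (b i)))\<^sup>2)"
  shows "(\<Sum>i<n. mean_square (\<lambda>x. g x * vec_poly (b i) x) - sqnorm (toeplitz g n *\<^sub>v b i))
    = n * mean_square g - (\<Sum>k<n. \<Sum>j<n. (cmod (fourier_coeff g (int j - int k)))\<^sup>2)"
proof -
  let ?M = "lebesgue_on {-pi..pi}"
  have pointwise: "(\<Sum>i<n. (cmod (vec_poly (b i) x))\<^sup>2) = n" for x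
  proof -
    \<comment> \<open>conjugated frequencies, since the inner product conjugates the basis vector\<close>
    let ?e = "vec n (\<lambda>k. cis (- of_int (int k) * x))"
    have "cmod (?e \<bullet>c (b i)) = cmod (vec_poly (b i) x)" if "i < n" for i
    proof -
      have "?e \<bullet>c (b i) = cnj (vec_poly (b i) x)"
        using b[OF that] by (simp add: scalar_prod_def vec_poly_def atLeast0LessThan cis_cnj mult.commute)
      then show ?thesis by simp
    qed
    then show ?thesis using parseval[of ?e] by (simp add: sqnorm_def)
  qed
  have "(\<Sum>i<n. mean_square (\<lambda>x. g x * vec_poly (b i) x))
    = (\<integral>x. (\<Sum>i<n. (cmod (g x * vec_poly (b i) x))\<^sup>2) \<partial>?M) / (2 * pi)"
    unfolding mean_square_def
    by (subst Bochner_Integration.integral_sum)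
       (auto simp: sum_divide_distrib intro!: integrable_mean_square bounded_measurable_mult g bounded_measurable_vec_poly)
  also have "(\<lambda>x. \<Sum>i<n. (cmod (g x * vec_poly (b i) x))\<^sup>2) = (\<lambda>x. n * (cmod (g x))\<^sup>2)"
    using pointwise by (simp add: norm_mult power_mult_distrib flip: sum_distrib_left) (simp add: mult.commute)
  finally have 1: "(\<Sum>i<n. mean_square (\<lambda>x. g x * vec_poly (b i) x)) = n * mean_square g"
    by (simp add: mean_square_def)
  have "sqnorm (toeplitz g n *\<^sub>v b i) = (\<Sum>j<n. (cmod (\<Sum>k<n. fourier_coeff g (int j - int k) * b i $ k))\<^sup>2)"
    if "i < n" for i
    using b[OF that] by (simp add: sqnorm_def scalar_prod_def atLeast0LessThan toeplitz_index)
  then have "(\<Sum>i<n. sqnorm (toeplitz g n *\<^sub>v b i))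
     = (\<Sum>i<n. \<Sum>j<n. (cmod (\<Sum>k<n. fourier_coeff g (int j - int k) * b i $ k))\<^sup>2)"
    by simp
  also have "\<dots> = (\<Sum>j<n. \<Sum>i<n. (cmod (\<Sum>k<n. fourier_coeff g (int j - int k) * b i $ k))\<^sup>2)"
    by (rule sum.swap)
  also have "\<dots> = (\<Sum>j<n. \<Sum>k<n. (cmod (fourier_coeff g (int j - int k)))\<^sup>2)"
  proof (rule sum.cong[OF refl])
    fix j
    let ?r = "vec n (\<lambda>k. cnj (fourier_coeff g (int j - int k)))"
    have "cmod (\<Sum>k<n. fourier_coeff g (int j - int k) * b i $ k) = cmod (?r \<bullet>c (b i))" if "i < n" for i
    proof -
      have "?r \<bullet>c (b i) = cnj (\<Sum>k<n. fourier_coeff g (int j - int k) * b i $ k)"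
        using b[OF that] by (simp add: scalar_prod_def atLeast0LessThan)
      then show ?thesis by (simp del: cnj_sum)
    qed
    then show "(\<Sum>i<n. (cmod (\<Sum>k<n. fourier_coeff g (int j - int k) * b i $ k))\<^sup>2)
      = (\<Sum>k<n. (cmod (fourier_coeff g (int j - int k)))\<^sup>2)"
      using parseval[of ?r] by (simp add: sqnorm_def)
  qed
  also have "\<dots> = (\<Sum>k<n. \<Sum>j<n. (cmod (fourier_coeff g (int j - int k)))\<^sup>2)"
    by (rule sum.swap)
  finally show ?thesis by (simp add: sum_subtractf 1)
qed

text \<open>On a right singular vector of length one the mean square of \<open>g\<close> times its polynomial lies between
  \<open>\<alpha>\<^sup>2\<close> and \<open>\<beta>\<^sup>2\<close>. A singular value up to \<open>t\<close> therefore contributes at least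
  \<open>\<alpha>\<^sup>2 - t\<^sup>2\<close> to the trace of the loss, while no summand of this trace is negative.\<close>
lemma toeplitz_singular_values:
  fixes \<alpha> \<beta> t :: real
  assumes g: "bounded_measurable g" and lo: "\<And>x. \<alpha> \<le> cmod (g x)" and hi: "\<And>x. cmod (g x) \<le> \<beta>"
    and t: "0 \<le> t" "t < \<alpha>"
  shows "size {#s \<in># singular_values (toeplitz g n). s \<le> \<beta>#} = n" (is ?P)
    and "size {#s \<in># singular_values (toeplitz g n). s \<le> t#} * (\<alpha>\<^sup>2 - t\<^sup>2)
      \<le> n * mean_square g - (\<Sum>k<n. \<Sum>j<n. (cmod (fourier_coeff g (int j - int k)))\<^sup>2)" (is ?Q)
proof -
  obtain b s where b: "\<And>i. i < n \<Longrightarrow> b i \<in> carrier_vec n"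
    and ortho: "\<And>i j. i < n \<Longrightarrow> j < n \<Longrightarrow> b i \<bullet>c (b j) = (if i = j then 1 else 0)"
    and B1: "\<And>v. v \<in> carrier_vec n \<Longrightarrow> sqnorm v = (\<Sum>i<n. (cmod (v \<bullet>c (b i)))\<^sup>2)"
    and B2: "\<And>v. v \<in> carrier_vec n \<Longrightarrow> sqnorm (toeplitz g n *\<^sub>v v) = (\<Sum>i<n. (s i)\<^sup>2 * (cmod (v \<bullet>c (b i)))\<^sup>2)"
    and s: "\<And>i. i < n \<Longrightarrow> s i \<ge> 0"
    and B3: "singular_values (toeplitz g n) = image_mset s (mset_set {..<n})"
    by (rule singular_value_decomposition[OF toeplitz_carrier(1)]) blast
  have one: "(\<Sum>j<n. c j * (cmod (b i \<bullet>c (b j)))\<^sup>2) = c i" if "i < n" for i and c :: "nat \<Rightarrow> real"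
  proof -
    have "(\<Sum>j<n. c j * (cmod (b i \<bullet>c (b j)))\<^sup>2) = (\<Sum>j<n. if j = i then c i else 0)"
      using that by (intro sum.cong) (auto simp: ortho)
    then show ?thesis using that by simp
  qed
  have norm_b: "sqnorm (b i) = 1" if "i < n" for i
    using one[OF that, of "\<lambda>_. 1"] B1[OF b[OF that]] by simp
  have norm_Tb: "sqnorm (toeplitz g n *\<^sub>v b i) = (s i)\<^sup>2" if "i < n" for i
    using one[OF that, of "\<lambda>j. (s j)\<^sup>2"] B2[OF b[OF that]] by simp
  define G where "G i = mean_square (\<lambda>x. g x * vec_poly (b i) x)" for i
  note bm = bounded_measurable_mult[OF g bounded_measurable_vec_poly] bounded_measurable_vec_poly
  have "0 \<le> \<alpha>" using t by simp
  have "0 \<le> \<beta>" using norm_ge_zero hi by (rule order_trans)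
  have G_ge: "\<alpha>\<^sup>2 \<le> G i" if "i < n" for i
  proof -
    have "\<alpha>\<^sup>2 * mean_square (vec_poly (b i)) \<le> 1 * G i"
      unfolding G_def using lo \<open>0 \<le> \<alpha>\<close>
      by (intro mean_square_mono bm) (auto simp: norm_mult power_mult_distrib intro!: mult_right_mono power_mono)
    then show ?thesis using norm_b[OF that] by (simp add: mean_square_vec_poly)
  qed
  have G_le: "G i \<le> \<beta>\<^sup>2" if "i < n" for i
  proof -
    have "1 * G i \<le> \<beta>\<^sup>2 * mean_square (vec_poly (b i))"
      unfolding G_def using hi
      by (intro mean_square_mono bm) (auto simp: norm_mult power_mult_distrib intro!: mult_right_mono power_mono)
    then show ?thesis using norm_b[OF that] by (simp add: mean_square_vec_poly)
  qed
  have s_le: "(s i)\<^sup>2 \<le> G i" if "i < n" for i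
    using sqnorm_toeplitz_le[OF g b[OF that]] norm_Tb[OF that] by (simp add: G_def)
  have count: "size {#x \<in># singular_values (toeplitz g n). x \<le> c#} = card {i\<in>{..<n}. s i \<le> c}" for c
    unfolding B3 by (simp add: filter_mset_image_mset Int_def conj_commute)
  have "s i \<le> \<beta>" if "i < n" for i
    using order_trans[OF s_le[OF that] G_le[OF that]] \<open>0 \<le> \<beta>\<close> by (simp add: power2_le_iff_abs_le)
  then have "{i\<in>{..<n}. s i \<le> \<beta>} = {..<n}" by auto
  then show ?P unfolding count by simp
  have "size {#s \<in># singular_values (toeplitz g n). s \<le> t#} * (\<alpha>\<^sup>2 - t\<^sup>2)
    = (\<Sum>i\<in>{i\<in>{..<n}. s i \<le> t}. \<alpha>\<^sup>2 - t\<^sup>2)"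
    unfolding count by simp
  also have "\<dots> \<le> (\<Sum>i\<in>{i\<in>{..<n}. s i \<le> t}. G i - (s i)\<^sup>2)"
    using G_ge s by (intro sum_mono diff_mono power_mono) auto
  also have "\<dots> \<le> (\<Sum>i<n. G i - (s i)\<^sup>2)"
    using s_le by (intro sum_mono2) auto
  also have "\<dots> = (\<Sum>i<n. G i - sqnorm (toeplitz g n *\<^sub>v b i))"
    using norm_Tb by simp
  also have "\<dots> = n * mean_square g - (\<Sum>k<n. \<Sum>j<n. (cmod (fourier_coeff g (int j - int k)))\<^sup>2)"
    unfolding G_def using g b B1 by (rule toeplitz_defect_trace)
  finally show ?Q .
qed

lemma fourier_coeff_trig:
  "fourier_coeff (\<lambda>x. \<Sum>i\<in>{- int N..int N}. c i * cis (of_int i * x)) m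
     = (if m \<in> {- int N..int N} then c m else 0)"
proof -
  have one: "fourier_coeff (\<lambda>_. 1) k = (if k = 0 then 1 else 0)" for k
    using integral_cis[of "- k"] by (simp add: fourier_coeff_def)
  have "fourier_coeff (\<lambda>x. \<Sum>i\<in>{- int N..int N}. c i * cis (of_int i * x)) m
    = (\<Sum>i\<in>{- int N..int N}. c i * fourier_coeff (\<lambda>_. 1) (m - i))"
    using fourier_coeff_mult_trig[OF bounded_measurable_const[of 1], of c "\<lambda>i. i" "{- int N..int N}" m] by simp
  also have "\<dots> = (\<Sum>i\<in>{- int N..int N}. if i = m then c m else 0)"
    unfolding one by (intro sum.cong) auto
  finally show ?thesis by simp
qed

text \<open>In a row at distance at least \<open>N\<close> from the upper and the lower edge, the convolution with the
  \<open>2 N + 1\<close> coefficients of \<open>p\<close> is not cut off by the truncation to size \<open>n\<close>.\<close>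
lemma toeplitz_product_interior_row:
  assumes g: "bounded_measurable g"
    and p: "\<And>x. p x = (\<Sum>i\<in>{- int N..int N}. c i * cis (of_int i * x))"
    and j: "N \<le> j" "j + N < n" and k: "k < n"
  shows "(toeplitz p n * toeplitz g n) $$ (j, k) = toeplitz (\<lambda>x. g x * p x) n $$ (j, k)"
proof -
  have pc: "fourier_coeff p m = (if m \<in> {- int N..int N} then c m else 0)" for m
    using fourier_coeff_trig[of c N m] by (simp add: p[abs_def])
  have "(toeplitz p n * toeplitz g n) $$ (j, k)
     = (\<Sum>l<n. fourier_coeff p (int j - int l) * fourier_coeff g (int l - int k))"
    using j k by (simp add: scalar_prod_def atLeast0LessThan toeplitz_index)
  also have "\<dots> = (\<Sum>l\<in>{j - N..j + N}. fourier_coeff p (int j - int l) * fourier_coeff g (int l - int k))"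
    using j by (intro sum.mono_neutral_right) (auto simp: pc)
  also have "\<dots> = (\<Sum>i\<in>{- int N..int N}. c i * fourier_coeff g (int j - int k - i))"
    using j by (intro sum.reindex_bij_witness[of _ "\<lambda>i. nat (int j - i)" "\<lambda>l. int j - int l"])
      (auto simp: pc algebra_simps)
  also have "\<dots> = toeplitz (\<lambda>x. g x * p x) n $$ (j, k)"
    using j k unfolding p by (simp add: toeplitz_index fourier_coeff_mult_trig[OF g])
  finally show ?thesis .
qed

lemma inverse_mat_left:
  assumes A: "A \<in> carrier_mat n n" and inv: "invertible_mat A"
  shows "inverse_mat A \<in> carrier_mat n n" "inverse_mat A * A = 1\<^sub>m n"
proof -
  obtain B where B: "A * B = 1\<^sub>m n" "B * A = 1\<^sub>m (dim_row B)"
    using inv A unfolding invertible_mat_def inverts_mat_def by auto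
  have "dim_col B = n" using arg_cong[OF B(1), of dim_col] by simp
  moreover have "dim_row B = n" using arg_cong[OF B(2), of dim_col] A by simp
  ultimately have Bc: "B \<in> carrier_mat n n" by blast
  then have "A \<in> Units (ring_mat TYPE(complex) n ())"
    using A B by (auto simp: Units_def ring_mat_def)
  then obtain C where C: "mat_inverse A = Some C"
    using mat_inverse(1)[OF A, where b = "()"] by (cases "mat_inverse A") auto
  then show "inverse_mat A \<in> carrier_mat n n" "inverse_mat A * A = 1\<^sub>m n"
    using mat_inverse(2)[OF A C] by (simp_all add: inverse_mat_def)
qed

text \<open>By passing to \<open>- h\<close>, whose essential supremum is \<open>- essinf M h\<close>; the value \<open>bot\<close> covers
  functions that are not measurable.\<close>
lemma essinf_AE: "AE x in M. essinf M h \<le> h x"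
proof (cases "h \<in> borel_measurable M")
  case True
  have "esssup M (\<lambda>x. - h x) = - essinf M h"
    using True by (simp add: essinf_def esssup_def ereal_Limsup_uminus)
  then show ?thesis using esssup_AE[of "\<lambda>x. - h x" M] by simp
qed (simp add: essinf_def)

text \<open>The functionals fed to the perturbation lemma are the rows of
  \<open>D = toeplitz f n - toeplitz p n * toeplitz g n\<close> near the two edges, at most \<open>2 N\<close> many. A
  vector annihilated by them is annihilated by \<open>D\<close>, and cancelling \<open>toeplitz p n\<close> shows that the preconditioned
  matrix acts like \<open>toeplitz g n\<close>. The lemma is used once for the values below \<open>\<alpha>\<close> and once,
  with the two matrices exchanged, for those above \<open>\<beta>\<close>. The threshold
  \<open>\<alpha> - e\<close> is replaced by \<open>0\<close> when it is negative, which keeps its square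
  below \<open>\<alpha>\<^sup>2\<close>.\<close>
lemma preconditioned_outlier_count:
  fixes \<alpha> \<beta> e :: real
  assumes g: "bounded_measurable g" and lo: "\<And>x. \<alpha> \<le> cmod (g x)" and hi: "\<And>x. cmod (g x) \<le> \<beta>"
    and p: "\<And>x. p x = (\<Sum>i\<in>{- int N..int N}. c i * cis (of_int i * x))"
    and inv: "invertible_mat (toeplitz p n)"
    and f: "toeplitz f n = toeplitz (\<lambda>x. g x * p x) n"
    and e: "e > 0" and a: "\<alpha> > 0"
  shows "outlier_count {\<alpha>..\<beta>} e (inverse_mat (toeplitz p n) * toeplitz f n) \<le>
    (n * mean_square g - (\<Sum>k<n. \<Sum>j<n. (cmod (fourier_coeff g (int j - int k)))\<^sup>2))
      / (\<alpha>\<^sup>2 - (max 0 (\<alpha> - e))\<^sup>2) + 4 * N"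
proof -
  define t where "t = max 0 (\<alpha> - e)"
  have t: "0 \<le> t" "t < \<alpha>" using e a by (auto simp: t_def)
  then have pos: "\<alpha>\<^sup>2 - t\<^sup>2 > 0" by (simp add: power_strict_mono)
  define A where "A = inverse_mat (toeplitz p n) * toeplitz f n"
  define B where "B = toeplitz g n"
  note P = inverse_mat_left[OF toeplitz_carrier(1) inv]
  have A: "A \<in> carrier_mat n n" using P by (simp add: A_def)
  have B: "B \<in> carrier_mat n n" by (simp add: B_def)
  define D where "D = toeplitz f n - toeplitz p n * B"
  have D: "D \<in> carrier_mat n n" 
    unfolding D_def by (intro minus_carrier_mat mult_carrier_mat[of _ n n] toeplitz_carrier B)
  define R where "R = map (row D) (filter (\<lambda>j. j < N \<or> n \<le> j + N) [0..<n])"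
  have R: "set R \<subseteq> carrier_vec n" using D by (auto simp: R_def)
  have "length R = card {j\<in>{..<n}. j < N \<or> n \<le> j + N}"
    using distinct_card[of "filter (\<lambda>j. j < N \<or> n \<le> j + N) [0..<n]"] by (simp add: R_def)
  also have "\<dots> \<le> card ({..<N} \<union> {n - N..<n})" by (rule card_mono) auto
  also have "\<dots> \<le> card {..<N} + card {n - N..<n}" by (rule card_Un_le)
  also have "\<dots> \<le> 2 * N" by simp
  finally have len: "length R \<le> 2 * N" .
  have agree: "A *\<^sub>v v = B *\<^sub>v v" if v: "v \<in> carrier_vec n" and R0: "\<And>r. r \<in> set R \<Longrightarrow> r \<bullet> v = 0" for v
  proof -
    have "D *\<^sub>v v = 0\<^sub>v n"
    proof (rule eq_vecI)
      fix j assume "j < dim_vec (0\<^sub>v n :: complex vec)"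
      then have j: "j < n" by simp
      have "row D j \<bullet> v = 0"
      proof (cases "j < N \<or> n \<le> j + N")
        case True
        then show ?thesis using j by (intro R0) (auto simp: R_def)
      next
        case False
        have "row D j = 0\<^sub>v n"
        proof (rule eq_vecI)
          fix k assume "k < dim_vec (0\<^sub>v n :: complex vec)"
          then have k: "k < n" by simp
          have "(toeplitz p n * toeplitz g n) $$ (j, k) = toeplitz (\<lambda>x. g x * p x) n $$ (j, k)"
            by (rule toeplitz_product_interior_row[OF g p]) (use False j k in auto)
          then show "row D j $ k = 0\<^sub>v n $ k"
            using j k by (simp add: D_def B_def f row_def del: index_mult_mat(1))
        qed (use D in auto)
        then show ?thesis using v by simp
      qed
      then show "(D *\<^sub>v v) $ j = 0\<^sub>v n $ j" using D j by simp
    qed (use D in auto)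
    moreover have "D *\<^sub>v v = toeplitz f n *\<^sub>v v - toeplitz p n *\<^sub>v (B *\<^sub>v v)"
      unfolding D_def using v B
      by (subst minus_mult_distrib_mat_vec[of _ n n])
         (auto simp: assoc_mult_mat_vec[OF toeplitz_carrier(1) B])
    ultimately have diff: "toeplitz f n *\<^sub>v v - toeplitz p n *\<^sub>v (B *\<^sub>v v) = 0\<^sub>v n" by simp
    have Tf: "toeplitz f n *\<^sub>v v = toeplitz p n *\<^sub>v (B *\<^sub>v v)"
    proof (rule eq_vecI)
      fix j assume "j < dim_vec (toeplitz p n *\<^sub>v (B *\<^sub>v v))"
      then show "(toeplitz f n *\<^sub>v v) $ j = (toeplitz p n *\<^sub>v (B *\<^sub>v v)) $ j"
        using arg_cong[OF diff, of "\<lambda>w. w $ j"] by (simp del: index_mult_mat_vec)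
    qed simp
    have "A *\<^sub>v v = inverse_mat (toeplitz p n) *\<^sub>v (toeplitz p n *\<^sub>v (B *\<^sub>v v))"
      unfolding A_def using v by (simp add: assoc_mult_mat_vec[OF P(1) toeplitz_carrier(1)] Tf)
    also have "\<dots> = B *\<^sub>v v"
      using v B by (simp add: P(2) flip: assoc_mult_mat_vec[OF P(1) toeplitz_carrier(1)])
    finally show ?thesis .
  qed
  obtain b s where s: "\<And>i. i < n \<Longrightarrow> s i \<ge> 0"
    and svA: "singular_values A = image_mset s (mset_set {..<n})"
    by (rule singular_value_decomposition[OF A]) blast
  have total: "size (singular_values A) = n" by (simp add: svA)
  have "\<beta> \<ge> 0" using norm_ge_zero hi by (rule order_trans)
  have ab: "\<alpha> \<le> \<beta>" using lo hi by (rule order_trans)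
  have low: "size {#s \<in># singular_values A. s \<le> t#} \<le>
     (n * mean_square g - (\<Sum>k<n. \<Sum>j<n. (cmod (fourier_coeff g (int j - int k)))\<^sup>2)) / (\<alpha>\<^sup>2 - t\<^sup>2) + 2 * N"
  proof -
    have "real (size {#s \<in># singular_values B. s \<le> t#}) \<le>
      (n * mean_square g - (\<Sum>k<n. \<Sum>j<n. (cmod (fourier_coeff g (int j - int k)))\<^sup>2)) / (\<alpha>\<^sup>2 - t\<^sup>2)"
      using toeplitz_singular_values(2)[OF g lo hi t, of n] pos by (simp add: B_def pos_le_divide_eq)
    then show ?thesis
      using singular_value_count_perturbation[OF A B R _ t(1)] agree len by fastforce
  qed
  have "n \<le> size {#s \<in># singular_values A. s \<le> \<beta>#} + 2 * N"
    using singular_value_count_perturbation[OF B A R _ \<open>\<beta> \<ge> 0\<close>] agree len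
      toeplitz_singular_values(1)[OF g lo hi t, of n] by (fastforce simp: B_def)
  moreover have "size {#s \<in># singular_values A. s \<le> \<beta>#} + size {#s \<in># singular_values A. \<not> s \<le> \<beta>#} = n"
    by (metis multiset_partition size_union total)
  ultimately have high: "size {#s \<in># singular_values A. \<not> s \<le> \<beta>#} \<le> 2 * N" by simp
  have "filter_mset (\<lambda>s. s \<notin> eps_extension {\<alpha>..\<beta>} e) (singular_values A)
     \<subseteq># filter_mset (\<lambda>s. s \<le> t) (singular_values A) + filter_mset (\<lambda>s. \<not> s \<le> \<beta>) (singular_values A)"
  proof (rule mset_subset_eqI)
    fix x
    have "x \<le> t \<or> \<not> x \<le> \<beta>" if "x \<notin> eps_extension {\<alpha>..\<beta>} e"
    proof (rule ccontr)
      assume "\<not> (x \<le> t \<or> \<not> x \<le> \<beta>)"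
      then have "x \<in> {\<alpha>..\<beta>} \<or> x \<in> ball \<alpha> e" by (auto simp: t_def dist_real_def)
      moreover have "\<alpha> \<in> {\<alpha>..\<beta>}" using ab by simp
      ultimately show False using that unfolding eps_extension_def by blast
    qed
    then show "count (filter_mset (\<lambda>s. s \<notin> eps_extension {\<alpha>..\<beta>} e) (singular_values A)) x
      \<le> count (filter_mset (\<lambda>s. s \<le> t) (singular_values A) + filter_mset (\<lambda>s. \<not> s \<le> \<beta>) (singular_values A)) x"
      by auto
  qed
  then have "outlier_count {\<alpha>..\<beta>} e A \<le>
     size {#s \<in># singular_values A. s \<le> t#} + size {#s \<in># singular_values A. \<not> s \<le> \<beta>#}"
    unfolding outlier_count_def by (metis size_mset_mono size_union)
  then show ?thesis using low high unfolding A_def[symmetric] t_def[symmetric] by linarith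
qed

lemma toeplitz_cong_AE:
  assumes "h \<in> borel_measurable (lebesgue_on {-pi..pi})" "h' \<in> borel_measurable (lebesgue_on {-pi..pi})"
    and "AE x in lebesgue_on {-pi..pi}. h x = h' x"
  shows "toeplitz h n = toeplitz h' n"
proof -
  have cis: "(\<lambda>x. cis (- of_int m * x)) \<in> borel_measurable (lebesgue_on {-pi..pi})" for m
    using bounded_measurable_cis unfolding bounded_measurable_def by blast
  have "fourier_coeff h m = fourier_coeff h' m" for m
  proof -
    have "AE x in lebesgue_on {-pi..pi}. h x * cis (- of_int m * x) = h' x * cis (- of_int m * x)"
      using assms(3) by eventually_elim simp
    then have "(\<integral>x. h x * cis (- of_int m * x) \<partial>lebesgue_on {-pi..pi})
        = (\<integral>x. h' x * cis (- of_int m * x) \<partial>lebesgue_on {-pi..pi})"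
      by (rule integral_cong_AE[OF borel_measurable_times[OF assms(1) cis] borel_measurable_times[OF assms(2) cis]])
    then show ?thesis by (simp add: fourier_coeff_def)
  qed
  then show ?thesis by (intro eq_matI) (simp_all add: toeplitz_index)
qed

theorem mainTheorem1:
  fixes f p :: "real \<Rightarrow> complex"
    and f1 f2 p1 p2 :: "real \<Rightarrow> real"
    and \<alpha> \<beta> :: real
  assumes "\<And>x. f x = of_real (f1 x) + \<i> * of_real (f2 x)"
    and "square_integrable f"
    and "AE x in lebesgue. f (x + 2 * pi) = f x"
    and "AE x in lebesgue. f1 (- x) = f1 x"
    and "AE x in lebesgue. f2 (- x) = - f2 x"
    and "\<And>x. p x = of_real (p1 x) + \<i> * of_real (p2 x)"
    and "trig_polynomial p"
    and "\<And>x. p1 (- x) = p1 x"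
    and "\<And>x. p2 (- x) = - p2 x"
    and "\<And>n. n \<ge> 1 \<Longrightarrow> invertible_mat (toeplitz p n)"
    and "AE x in lebesgue_on {-pi..pi}. Re (f x / p x) > 0"
    and "ereal \<alpha> = essinf (lebesgue_on {-pi..pi}) (\<lambda>x. ereal (cmod (f x / p x)))"
    and "ereal \<beta> = esssup (lebesgue_on {-pi..pi}) (\<lambda>x. ereal (cmod (f x / p x)))"
    and "0 < \<alpha>"
  shows "general_cluster {\<alpha>..\<beta>} (\<lambda>n. inverse_mat (toeplitz p n) * toeplitz f n)"
proof -
  let ?M = "lebesgue_on {-pi..pi}"
  obtain N c where p: "\<And>x. p x = (\<Sum>m\<in>{- int N..int N}. c m * cis (of_int m * x))"
    by (rule trig_polynomialE[OF assms(7)]) blast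
  have f_meas: "f \<in> borel_measurable ?M"
    using assms(2) unfolding square_integrable_def set_borel_measurable_def
    by (subst borel_measurable_restrict_space_iff) auto
  have p_meas: "p \<in> borel_measurable ?M"
    using trig_polynomial_bounded_measurable[OF assms(7)] by (simp add: bounded_measurable_def)
  have bounds: "AE x in ?M. \<alpha> \<le> cmod (f x / p x) \<and> cmod (f x / p x) \<le> \<beta>"
    using essinf_AE[of ?M "\<lambda>x. ereal (cmod (f x / p x))"] esssup_AE[of "\<lambda>x. ereal (cmod (f x / p x))" ?M]
    unfolding assms(12,13)[symmetric] by eventually_elim simp
  have "ae_filter ?M \<noteq> bot"
    by (simp add: ae_filter_eq_bot_iff emeasure_restrict_space)
  then obtain x0 where "\<alpha> \<le> cmod (f x0 / p x0) \<and> cmod (f x0 / p x0) \<le> \<beta>"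
    using eventually_happens[OF bounds] by blast
  then have ab: "\<alpha> \<le> \<beta>" by linarith
  \<comment> \<open>the quotient, changed on a null set so that its bounds hold everywhere\<close>
  define g where "g x = (if \<alpha> \<le> cmod (f x / p x) \<and> cmod (f x / p x) \<le> \<beta> then f x / p x else of_real \<alpha>)" for x
  have lo: "\<alpha> \<le> cmod (g x)" and hi: "cmod (g x) \<le> \<beta>" for x
    using ab assms(14) by (auto simp: g_def)
  have q_meas: "(\<lambda>x. f x / p x) \<in> borel_measurable ?M"
    using f_meas p_meas by (rule borel_measurable_divide)
  have "(\<lambda>x. cmod (f x / p x)) \<in> borel_measurable ?M"
    using q_meas by simp
  then have "{x \<in> space ?M. \<alpha> \<le> cmod (f x / p x) \<and> cmod (f x / p x) \<le> \<beta>} \<in> sets ?M"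
    by (intro sets.sets_Collect_conj borel_measurable_le borel_measurable_const)
  then have "g \<in> borel_measurable ?M"
    unfolding g_def[abs_def] by (intro measurable_If q_meas borel_measurable_const)
  then have g: "bounded_measurable g"
    using hi unfolding bounded_measurable_def by (auto intro: boundedI)
  have "AE x in ?M. f x = g x * p x"
    using bounds
  proof eventually_elim
    case (elim x)
    then have "p x \<noteq> 0" using assms(14) by auto
    with elim show ?case by (simp add: g_def)
  qed
  then have f: "toeplitz f n = toeplitz (\<lambda>x. g x * p x) n" for n
    using f_meas p_meas g unfolding bounded_measurable_def
    by (intro toeplitz_cong_AE borel_measurable_times) simp_all
  define D where "D n = n * mean_square g - (\<Sum>k<n. \<Sum>j<n. (cmod (fourier_coeff g (int j - int k)))\<^sup>2)" for n :: nat
  have D: "(\<lambda>n. D n / n) \<longlonglongrightarrow> 0"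
    unfolding D_def by (rule toeplitz_defect_tendsto[OF g])
  show ?thesis unfolding general_cluster_def
  proof (intro allI impI)
    fix e :: real assume e: "e > 0"
    define K where "K = \<alpha>\<^sup>2 - (max 0 (\<alpha> - e))\<^sup>2"
    let ?count = "\<lambda>n. real (outlier_count {\<alpha>..\<beta>} e (inverse_mat (toeplitz p n) * toeplitz f n)) / n"
    have upper: "?count n \<le> D n / n / K + 4 * N / n" if "n \<ge> 1" for n
    proof -
      have "real (outlier_count {\<alpha>..\<beta>} e (inverse_mat (toeplitz p n) * toeplitz f n)) \<le> D n / K + 4 * N"
        using preconditioned_outlier_count[OF g lo hi p assms(10)[OF that] f e assms(14)]
        by (simp add: D_def K_def)
      then have "?count n \<le> (D n / K + 4 * N) / n" by (intro divide_right_mono) auto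
      then show ?thesis by (simp add: add_divide_distrib mult.commute)
    qed
    have lim: "(\<lambda>n. D n / n / K + 4 * N / n) \<longlonglongrightarrow> 0"
      using tendsto_add[OF tendsto_divide_zero[OF D, of K] lim_const_over_n[of "4 * real N"]] by simp
    show "?count \<longlonglongrightarrow> 0"
    proof (rule tendsto_sandwich[OF _ _ tendsto_const lim])
      show "\<forall>\<^sub>F n in sequentially. 0 \<le> ?count n" by (rule always_eventually) simp
      show "\<forall>\<^sub>F n in sequentially. ?count n \<le> D n / n / K + 4 * N / n"
        using upper by (rule eventually_sequentiallyI)
    qed
  qed
qed

end
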